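(* Let $M$ be an $N$-dimensional smooth manifold ($N\ge2$) with a Riemannian metric $a_{ij}(x)$ and a 1-form $b_i(x)$ of unit Riemannian length, $a^{ij}b_ib_j=1$. Let $K(x,y)$ be the Finsleroid–Finsler metric function determined by $a_{ij}$, $b_i$ and a constant Finsleroid charge $g$, $-2<g<2$. Then, at all $(x,y)\in TM\setminus 0$ with $q(x,y)\neq0$, the geodesic spray coefficients $G^i=\gamma^i{}_{nm}y^ny^m$ of $K$ can be written in the form $$G^i=c_1\frac1q\,y^jy^h(\nabla_jb_h)\,v^i+c_2\,y^hb^j(\nabla_jb_h)\,v^i+c_3\,q\,f^i+a^i{}_{km}y^ky^m$$ with $$c_1=g,\qquad c_2=g^2,\qquad c_3=-g,$$ that is, $$G^i=g\Bigl(\frac1q\,y^jy^h\nabla_jb_h+g\,y^hb^j\nabla_jb_h\Bigr)v^i-g\,q\,f^i+a^i{}_{km}y^ky^m .$$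
   Context: Conventions. $(x^i,y^i)$ are standard local coordinates on $TM$, and repeated indices are summed. $a^{ij}$ is the inverse of $a_{ij}$, $a^k{}_{ij}=\frac12a^{kn}(\partial_ja_{ni}+\partial_ia_{nj}-\partial_na_{ji})$ are the Riemannian Christoffel symbols ($\partial_j=\partial/\partial x^j$), and $\nabla$ is the Levi-Civita covariant derivative of $a_{ij}$, so $\nabla_jb_h=\partial_jb_h-a^k{}_{jh}b_k$. Notation: $b^i=a^{ij}b_j$; $b=b_iy^i$; $S=\sqrt{a_{ij}y^iy^j}$; $q=\sqrt{(a_{ij}-b_ib_j)y^iy^j}=\sqrt{S^2-b^2}$; $v^i=y^i-b\,b^i$; $f_{mn}=\nabla_mb_n-\nabla_nb_m=\partial_mb_n-\partial_nb_m$; $f^i{}_n=a^{ik}f_{kn}$; $f^i=f^i{}_ny^n$. Finsleroid–Finsler metric function: with $h=\sqrt{1-\frac14g^2}$ and $G=g/h$ (a scalar, not to be confused with the $G^i$), $$K(x,y)=\sqrt{B}\;e^{\frac12G\Phi},\qquad B=b^2+g\,q\,b+q^2,$$ $$\Phi=\pm\frac{\pi}{2}+\arctan\frac G2-\arctan\Bigl(\frac{q+\frac g2b}{hb}\Bigr),$$ with the sign $+$ if $b>0$ and $-$ if $b<0$; at $b=0$ (with $y\neq0$), $\Phi$ takes the common limit value $\arctan\frac G2$. $K$ is smooth where $y\ne0$ is not proportional to the vector $b^i$, i.e. where $q\neq0$. The scalar $g$ is called the Finsleroid charge. The Finslerian metric tensor is $g_{ij}=\frac12\,\partial^2K^2/\partial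 y^i\partial y^j$, with inverse $g^{ij}$. The Finslerian Christoffel symbols are $\gamma^k{}_{ij}=\frac12g^{kn}(\partial_jg_{ni}+\partial_ig_{nj}-\partial_ng_{ji})$, and the geodesic spray coefficients are $G^k=\gamma^k{}_{ij}y^iy^j$ (no factor $\frac12$). *)

theory Defs
  imports "HOL-Analysis.Analysis"
begin

definition partial :: "'n::finite \<Rightarrow> (real^'n \<Rightarrow> real) \<Rightarrow> real^'n \<Rightarrow> real" where
  "partial i f x = deriv (\<lambda>t. f (x + t *\<^sub>R axis i 1)) 0"

text \<open>Only meaningful for open \<open>U\<close>, since \<open>partial\<close> looks at a neighbourhood of the point.\<close>

primrec Ck_on :: "nat \<Rightarrow> (real^'n::finite) set \<Rightarrow> (real^'n \<Rightarrow> real) \<Rightarrow> bool" where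
  "Ck_on 0 U f \<longleftrightarrow> continuous_on U f"
| "Ck_on (Suc k) U f \<longleftrightarrow>
     (\<forall>x\<in>U. f differentiable (at x)) \<and> (\<forall>i. Ck_on k U (partial i f))"

definition smooth_on :: "(real^'n::finite) set \<Rightarrow> (real^'n \<Rightarrow> real) \<Rightarrow> bool" where
  "smooth_on U f \<longleftrightarrow> (\<forall>k. Ck_on k U f)"

text \<open>A chart is a pair of its domain and its coordinate map; values of the coordinate map
  outside the domain are irrelevant.\<close>

type_synonym ('m, 'n) chart = "'m set \<times> ('m \<Rightarrow> real^'n)"

definition coord_range :: "('m, 'n::finite) chart \<Rightarrow> (real^'n) set" where
  "coord_range c = snd c ` fst c"

definition is_chart :: "'m topology \<Rightarrow> ('m, 'n::finite) chart \<Rightarrow> bool" where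
  "is_chart M c \<longleftrightarrow> openin M (fst c) \<and> open (coord_range c) \<and>
     homeomorphic_map (subtopology M (fst c)) (top_of_set (coord_range c)) (snd c)"

definition transition :: "('m, 'n::finite) chart \<Rightarrow> ('m, 'n) chart \<Rightarrow> real^'n \<Rightarrow> real^'n" where
  "transition c d x = snd d (inv_into (fst c) (snd c) x)"

definition smooth_manifold :: "'m topology \<Rightarrow> ('m, 'n::finite) chart set \<Rightarrow> bool" where
  "smooth_manifold M \<A> \<longleftrightarrow>
     Hausdorff_space M \<and> second_countable M \<and>
     (\<forall>c\<in>\<A>. is_chart M c) \<and> (\<Union>c\<in>\<A>. fst c) = topspace M \<and>
     (\<forall>c\<in>\<A>. \<forall>d\<in>\<A>. \<forall>k. smooth_on (snd c ` (fst c \<inter> fst d)) (\<lambda>x. transition c d x $ k))"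

definition jacobian :: "('m, 'n::finite) chart \<Rightarrow> ('m, 'n) chart \<Rightarrow> real^'n \<Rightarrow> 'n \<Rightarrow> 'n \<Rightarrow> real" where
  "jacobian c d x k i = partial i (\<lambda>z. transition c d z $ k) x"

text \<open>Covariant tensor fields are families of component functions, one for each chart of the
  atlas and depending on the coordinates of that chart, related by the tensor transformation law
  on overlaps.\<close>

definition one_form ::
  "('m, 'n::finite) chart set \<Rightarrow> (('m, 'n) chart \<Rightarrow> real^'n \<Rightarrow> real^'n) \<Rightarrow> bool" where
  "one_form \<A> b \<longleftrightarrow>
     (\<forall>c\<in>\<A>. \<forall>i. smooth_on (coord_range c) (\<lambda>x. b c x $ i)) \<and>
     (\<forall>c\<in>\<A>. \<forall>d\<in>\<A>. \<forall>p\<in>fst c \<inter> fst d. \<forall>i.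
        b c (snd c p) $ i = (\<Sum>k\<in>UNIV. jacobian c d (snd c p) k i * b d (snd d p) $ k))"

definition riemannian_metric ::
  "('m, 'n::finite) chart set \<Rightarrow> (('m, 'n) chart \<Rightarrow> real^'n \<Rightarrow> real^'n^'n) \<Rightarrow> bool" where
  "riemannian_metric \<A> a \<longleftrightarrow>
     (\<forall>c\<in>\<A>. \<forall>i j. smooth_on (coord_range c) (\<lambda>x. a c x $ i $ j)) \<and>
     (\<forall>c\<in>\<A>. \<forall>d\<in>\<A>. \<forall>p\<in>fst c \<inter> fst d. \<forall>i j.
        a c (snd c p) $ i $ j =
          (\<Sum>k\<in>UNIV. \<Sum>l\<in>UNIV. jacobian c d (snd c p) k i * jacobian c d (snd c p) l j
             * a d (snd d p) $ k $ l)) \<and>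
     (\<forall>c\<in>\<A>. \<forall>x\<in>coord_range c.
        (\<forall>i j. a c x $ i $ j = a c x $ j $ i) \<and>
        (\<forall>y. y \<noteq> 0 \<longrightarrow> (\<Sum>i\<in>UNIV. \<Sum>j\<in>UNIV. a c x $ i $ j * y $ i * y $ j) > 0))"

text \<open>Below, \<open>A\<close> is a field of matrices (components of a metric) and \<open>\<beta>\<close> a field of covectors on
  a coordinate domain; \<open>\<alpha>\<close> and \<open>w\<close> are their values at a single point.\<close>

definition christoffel :: "(real^'n \<Rightarrow> real^'n^'n) \<Rightarrow> real^'n \<Rightarrow> 'n::finite \<Rightarrow> 'n \<Rightarrow> 'n \<Rightarrow> real" where
  "christoffel A x k i j = 1/2 * (\<Sum>n\<in>UNIV. matrix_inv (A x) $ k $ n *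
     (partial j (\<lambda>z. A z $ n $ i) x + partial i (\<lambda>z. A z $ n $ j) x
      - partial n (\<lambda>z. A z $ j $ i) x))"

definition nabla ::
  "(real^'n \<Rightarrow> real^'n^'n) \<Rightarrow> (real^'n \<Rightarrow> real^'n) \<Rightarrow> real^'n \<Rightarrow> 'n::finite \<Rightarrow> 'n \<Rightarrow> real" where
  "nabla A \<beta> x j h =
     partial j (\<lambda>z. \<beta> z $ h) x - (\<Sum>k\<in>UNIV. christoffel A x k j h * \<beta> x $ k)"

definition f_lower ::
  "(real^'n \<Rightarrow> real^'n^'n) \<Rightarrow> (real^'n \<Rightarrow> real^'n) \<Rightarrow> real^'n \<Rightarrow> 'n::finite \<Rightarrow> 'n \<Rightarrow> real" where
  "f_lower A \<beta> x m n = nabla A \<beta> x m n - nabla A \<beta> x n m"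

definition f_mixed ::
  "(real^'n \<Rightarrow> real^'n^'n) \<Rightarrow> (real^'n \<Rightarrow> real^'n) \<Rightarrow> real^'n \<Rightarrow> 'n::finite \<Rightarrow> 'n \<Rightarrow> real" where
  "f_mixed A \<beta> x i n = (\<Sum>k\<in>UNIV. matrix_inv (A x) $ i $ k * f_lower A \<beta> x k n)"

definition f_vec ::
  "(real^'n \<Rightarrow> real^'n^'n) \<Rightarrow> (real^'n \<Rightarrow> real^'n) \<Rightarrow> real^'n \<Rightarrow> real^'n \<Rightarrow> 'n::finite \<Rightarrow> real" where
  "f_vec A \<beta> x y i = (\<Sum>n\<in>UNIV. f_mixed A \<beta> x i n * y $ n)"

definition raise :: "real^'n^'n \<Rightarrow> real^'n \<Rightarrow> 'n::finite \<Rightarrow> real" where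
  "raise \<alpha> w i = (\<Sum>j\<in>UNIV. matrix_inv \<alpha> $ i $ j * w $ j)"

definition norm_sq :: "real^'n^'n \<Rightarrow> real^'n::finite \<Rightarrow> real" where
  "norm_sq \<alpha> w = (\<Sum>i\<in>UNIV. \<Sum>j\<in>UNIV. matrix_inv \<alpha> $ i $ j * w $ i * w $ j)"

definition b_scalar :: "real^'n \<Rightarrow> real^'n::finite \<Rightarrow> real" where
  "b_scalar w y = (\<Sum>i\<in>UNIV. w $ i * y $ i)"

definition q_scalar :: "real^'n^'n \<Rightarrow> real^'n \<Rightarrow> real^'n::finite \<Rightarrow> real" where
  "q_scalar \<alpha> w y =
     sqrt (\<Sum>i\<in>UNIV. \<Sum>j\<in>UNIV. (\<alpha> $ i $ j - w $ i * w $ j) * y $ i * y $ j)"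

definition v_vec :: "real^'n^'n \<Rightarrow> real^'n \<Rightarrow> real^'n \<Rightarrow> 'n::finite \<Rightarrow> real" where
  "v_vec \<alpha> w y i = y $ i - b_scalar w y * raise \<alpha> w i"

definition h_charge :: "real \<Rightarrow> real" where
  "h_charge g = sqrt (1 - g\<^sup>2 / 4)"

definition G_charge :: "real \<Rightarrow> real" where
  "G_charge g = g / h_charge g"

text \<open>The value at \<open>b = 0\<close> is the common limit of the two branches, valid for \<open>q > 0\<close>.\<close>

definition finsleroid_Phi :: "real \<Rightarrow> real \<Rightarrow> real \<Rightarrow> real" where
  "finsleroid_Phi g q b =
     (if b = 0 then arctan (G_charge g / 2)
      else (if b > 0 then pi/2 else - (pi/2)) + arctan (G_charge g / 2)
             - arctan ((q + g/2 * b) / (h_charge g * b)))"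

definition finsleroid_B :: "real \<Rightarrow> real \<Rightarrow> real \<Rightarrow> real" where
  "finsleroid_B g q b = b\<^sup>2 + g * q * b + q\<^sup>2"

definition finsleroid_K :: "real \<Rightarrow> real^'n^'n \<Rightarrow> real^'n \<Rightarrow> real^'n::finite \<Rightarrow> real" where
  "finsleroid_K g \<alpha> w y =
     (let b = b_scalar w y; q = q_scalar \<alpha> w y
      in sqrt (finsleroid_B g q b) * exp (1/2 * G_charge g * finsleroid_Phi g q b))"

definition finsler_metric :: "(real^'n \<Rightarrow> real^'n \<Rightarrow> real) \<Rightarrow> real^'n \<Rightarrow> real^'n \<Rightarrow> real^'n::finite^'n" where
  "finsler_metric K x y =
     (\<chi> i j. 1/2 * partial i (partial j (\<lambda>z. (K x z)\<^sup>2)) y)"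

text \<open>The \<open>x\<close>-derivatives in the Finslerian Christoffel symbols are taken at fixed \<open>y\<close>;
  there is no factor \<open>1/2\<close> in the spray coefficients.\<close>

definition finsler_christoffel ::
  "(real^'n \<Rightarrow> real^'n \<Rightarrow> real) \<Rightarrow> real^'n \<Rightarrow> real^'n \<Rightarrow> 'n::finite \<Rightarrow> 'n \<Rightarrow> 'n \<Rightarrow> real" where
  "finsler_christoffel K x y = christoffel (\<lambda>z. finsler_metric K z y) x"

definition spray_coeff :: "(real^'n \<Rightarrow> real^'n \<Rightarrow> real) \<Rightarrow> real^'n \<Rightarrow> real^'n \<Rightarrow> 'n::finite \<Rightarrow> real" where
  "spray_coeff K x y i =
     (\<Sum>n\<in>UNIV. \<Sum>m\<in>UNIV. finsler_christoffel K x y i n m * y $ n * y $ m)"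

definition spray_ansatz ::
  "real \<Rightarrow> real \<Rightarrow> real \<Rightarrow> (real^'n \<Rightarrow> real^'n^'n) \<Rightarrow> (real^'n \<Rightarrow> real^'n)
     \<Rightarrow> real^'n \<Rightarrow> real^'n \<Rightarrow> 'n::finite \<Rightarrow> real" where
  "spray_ansatz c1 c2 c3 A \<beta> x y i =
     (let q = q_scalar (A x) (\<beta> x) y; v = v_vec (A x) (\<beta> x) y i in
        c1 * (1/q) * (\<Sum>j\<in>UNIV. \<Sum>h\<in>UNIV. y $ j * y $ h * nabla A \<beta> x j h) * v
      + c2 * (\<Sum>h\<in>UNIV. \<Sum>j\<in>UNIV. y $ h * raise (A x) (\<beta> x) j * nabla A \<beta> x j h) * v
      + c3 * q * f_vec A \<beta> x y i
      + (\<Sum>k\<in>UNIV. \<Sum>m\<in>UNIV. christoffel A x i k m * y $ k * y $ m))"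

end

theory Submission
  imports Defs
begin

text \<open>Write \<open>s = a\<^sub>i\<^sub>j y\<^sup>i y\<^sup>j\<close> and \<open>E = exp (G \<Phi>)\<close>, so that \<open>K\<^sup>2 = B E\<close>. Along any curve,
  \<open>\<Phi>' = h (q b' - b q') / B\<close>, and everything simplifies to \<open>(K\<^sup>2)' = E (s' + 2 g q b')\<close>.
  Hence \<open>g\<^sub>i\<^sub>j y\<^sup>j = E (a\<^sub>i\<^sub>j y\<^sup>j + g q b\<^sub>i)\<close>, and this covector determines the lowered spray
  \<open>g\<^sub>i\<^sub>k G\<^sup>k\<close>. By nondegeneracy of \<open>g\<^sub>i\<^sub>j\<close> it then suffices to apply \<open>g\<^sub>i\<^sub>j\<close> to the claimed spray;
  the terms match because \<open>b\<^sup>h \<nabla>\<^sub>j b\<^sub>h = 0\<close> (unit length) and \<open>y\<^sub>i f\<^sup>i = 0\<close>.\<close>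

subsection \<open>Derivatives of the Finsleroid function\<close>


text \<open>Differentiating the whole tensor g_ij in x, or inverting it, would be unwieldy; neither
  is done. The x-derivatives keep y fixed, so (d_m g_ij) y^j = d_m (g_ij y^j), and the lowered spray
  y^m d_m (g_kj y^j) - (1/2) d_k (g_ij y^i y^j) contains no other derivative of g_ij. For the
  entries of g_ij themselves only the existence of x-derivatives is shown. The inverse is avoided by
  applying g_ij to the claimed spray X: g_ij is E times a_ij plus a form in the two covectors
  \<open>w\<close> and \<open>v\<close>, so only the numbers \<open>w\<close> . X and
  \<open>v\<close> . X matter.

  This also explains the constants. The lowered spray contains -g q E times the curl of b, which
  forces the term -g q f^i. That term adds -g q k to \<open>w\<close> . X, where k = y^h b^j nabla_j
  b_h, and its unwanted effect is compensated exactly by g^2 k in the coefficient of v^i. The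
  remaining part of that coefficient comes from the derivative of b along y.

  The case distinction in \<open>finsleroid_Phi\<close> and the root in q make the explicit formulas
  local: they are established for q > 0 and transferred to derivatives through neighbourhoods on
  which q stays positive.\<close>

lemma h_charge_pos:
  assumes "-2 < g" "g < 2"
  shows "h_charge g > 0" "(h_charge g)\<^sup>2 = 1 - g\<^sup>2/4" "h_charge g * G_charge g = g"
proof -
  have "\<bar>g\<bar> < \<bar>2\<bar>" using assms by auto
  then have "g\<^sup>2 < 2\<^sup>2" by (metis abs_le_square_iff not_less)
  then have *: "1 - g\<^sup>2/4 > 0" by simp
  then show "h_charge g > 0" "(h_charge g)\<^sup>2 = 1 - g\<^sup>2/4" unfolding h_charge_def by auto
  with * show "h_charge g * G_charge g = g" unfolding G_charge_def by auto
qed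

text \<open>The two squared terms are the numerator and the denominator of the \<open>arctan\<close>
  argument in \<open>finsleroid_Phi\<close>. This is why B appears as the denominator when that
  angle is differentiated.\<close>

lemma finsleroid_B_eq:
  assumes "-2 < g" "g < 2"
  shows "finsleroid_B g q b = (q + g/2 * b)\<^sup>2 + (h_charge g * b)\<^sup>2"
  unfolding finsleroid_B_def power_mult_distrib h_charge_pos(2)[OF assms]
  by (simp add: power2_eq_square field_simps)

lemma finsleroid_B_pos:
  assumes "-2 < g" "g < 2" "q > 0"
  shows "finsleroid_B g q b > 0"
proof (cases "b = 0")
  case True
  then show ?thesis using assms by (simp add: finsleroid_B_def)
next
  case False
  then have "(h_charge g * b)\<^sup>2 > 0" using h_charge_pos(1)[OF assms(1,2)] by simp
  then show ?thesis unfolding finsleroid_B_eq[OF assms(1,2)]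
    by (smt (verit) zero_le_power2)
qed

text \<open>Up to the constant \<open>arctan (G_charge g / 2)\<close>, Phi is the polar angle of the
  point (q + g b / 2, h b), whose squared radius is B. The formula is the usual (X Y' - Y X') / (X^2
  + Y^2), in which the g b b' terms cancel.\<close>

lemma DERIV_finsleroid_Phi:
  assumes g: "-2 < g" "g < 2"
    and q: "(q has_real_derivative q') (at t)" and b: "(b has_real_derivative b') (at t)"
    and pos: "q t > 0"
  shows "((\<lambda>t. finsleroid_Phi g (q t) (b t)) has_real_derivative
           h_charge g * (q t * b' - b t * q') / finsleroid_B g (q t) (b t)) (at t)"
proof -
  let ?h = "h_charge g"
  note h = h_charge_pos[OF g]
  have Bp: "finsleroid_B g (q t) (b t) > 0" using finsleroid_B_pos[OF g pos] .
  have cq: "isCont q t" and cb: "isCont b t" using q b by (auto intro: DERIV_isCont)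
  show ?thesis
  proof (cases "b t = 0")
    case False
    define c where "c = (if b t > 0 then pi/2 else - (pi/2)) + arctan (G_charge g / 2)"
    \<comment> \<open>Away from b = 0 the sign of b is locally constant, so one branch of the
      definition applies near t.\<close>
    have "\<forall>\<^sub>F s in nhds t. (b s > 0 \<longleftrightarrow> b t > 0) \<and> b s \<noteq> 0"
    proof (cases "b t > 0")
      case True
      have "\<forall>\<^sub>F s in nhds t. b s > 0"
        using cb True by (metis isCont_def tendsto_at_iff_tendsto_nhds order_tendstoD(1))
      then show ?thesis by eventually_elim (use True in auto)
    next
      case 2: False
      then have "b t < 0" using False by auto
      then have "\<forall>\<^sub>F s in nhds t. b s < 0"
        using cb by (metis isCont_def tendsto_at_iff_tendsto_nhds order_tendstoD(2))
      then show ?thesis by eventually_elim (use 2 in auto)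
    qed
    then have ev: "\<forall>\<^sub>F s in nhds t. finsleroid_Phi g (q s) (b s)
        = c - arctan ((q s + g/2 * b s) / (?h * b s))"
      by eventually_elim (auto simp: finsleroid_Phi_def c_def)
    have nz: "?h * b t \<noteq> 0" using h False by auto
    let ?u = "(q t + g/2 * b t) / (?h * b t)"
    have 1: "inverse (1 + ?u\<^sup>2) = (?h * b t)\<^sup>2 / finsleroid_B g (q t) (b t)"
      using nz Bp unfolding finsleroid_B_eq[OF g] by (simp add: field_simps)
    have "((\<lambda>s. c - arctan ((q s + g/2 * b s) / (?h * b s))) has_real_derivative
        - (inverse (1 + ?u\<^sup>2) * (((q' + g/2 * b') * (?h * b t) - (q t + g/2 * b t) * (?h * b'))
            / (?h * b t)\<^sup>2))) (at t)"
      using nz by (auto intro!: derivative_eq_intros q b simp: power2_eq_square)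
    also have "- (inverse (1 + ?u\<^sup>2) * (((q' + g/2 * b') * (?h * b t) - (q t + g/2 * b t) * (?h * b'))
            / (?h * b t)\<^sup>2)) = ?h * (q t * b' - b t * q') / finsleroid_B g (q t) (b t)"
      unfolding 1 using nz Bp by (simp add: field_simps)
    finally show ?thesis using DERIV_cong_ev[OF refl ev refl] by simp
  next
    case True
    have "((\<lambda>s. q s + g/2 * b s) \<longlongrightarrow> q t + g/2 * b t) (nhds t)"
      using cq cb unfolding isCont_def tendsto_at_iff_tendsto_nhds by (intro tendsto_intros)
    then have "\<forall>\<^sub>F s in nhds t. q s + g/2 * b s > 0"
      using True pos by (auto intro: order_tendstoD)
    \<comment> \<open>At b = 0 the reciprocal identity for \<open>arctan\<close> absorbs the jump of
      pi, so both branches and the limit value become one smooth expression. Its denominator is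
      positive near t because q > 0.\<close>
    then have ev: "\<forall>\<^sub>F s in nhds t. finsleroid_Phi g (q s) (b s)
        = arctan (G_charge g / 2) + arctan ((?h * b s) / (q s + g/2 * b s))"
    proof eventually_elim
      case (elim s)
      let ?x = "?h * b s" and ?y = "q s + g/2 * b s"
      show ?case
      proof (cases "b s = 0")
        case True then show ?thesis by (simp add: finsleroid_Phi_def)
      next
        case False
        have "arctan (1 / (?x/?y)) = sgn (?x/?y) * pi/2 - arctan (?x/?y)"
        proof -
          have "?x/?y \<noteq> 0" using False elim h by auto
          from Transcendental.arctan_inverse[OF this] show ?thesis by simp
        qed
        moreover have "sgn (?x/?y) = (if b s > 0 then 1 else -1)"
          using False elim h by (auto simp: sgn_divide sgn_mult)
        ultimately show ?thesis using False by (auto simp: finsleroid_Phi_def)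
      qed
    qed
    have "((\<lambda>s. arctan (G_charge g / 2) + arctan ((?h * b s) / (q s + g/2 * b s)))
        has_real_derivative ?h * (q t * b' - b t * q') / finsleroid_B g (q t) (b t)) (at t)"
      using True pos
      by (auto intro!: derivative_eq_intros q b simp: finsleroid_B_def power2_eq_square)
    then show ?thesis using DERIV_cong_ev[OF refl ev refl] by simp
  qed
qed

definition E_factor :: "real \<Rightarrow> real \<Rightarrow> real \<Rightarrow> real" where
  "E_factor g q b = exp (G_charge g * finsleroid_Phi g q b)"

text \<open>The factor h in the derivative of Phi meets G = g / h in the exponent, and
  \<open>h_charge\<close> disappears from all later formulas.\<close>

lemma DERIV_E_factor:
  assumes g: "-2 < g" "g < 2"
    and q: "(q has_real_derivative q') (at t)" and b: "(b has_real_derivative b') (at t)"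
    and pos: "q t > 0"
  shows "((\<lambda>t. E_factor g (q t) (b t)) has_real_derivative
           E_factor g (q t) (b t) * (g / finsleroid_B g (q t) (b t) * (q t * b' - b t * q'))) (at t)"
proof -
  have "((\<lambda>t. exp (G_charge g * finsleroid_Phi g (q t) (b t))) has_real_derivative
      exp (G_charge g * finsleroid_Phi g (q t) (b t)) *
      ((h_charge g * (q t * b' - b t * q') / finsleroid_B g (q t) (b t)) * G_charge g)) (at t)"
    by (auto intro!: derivative_eq_intros DERIV_finsleroid_Phi[OF g q b pos])
  moreover have "(h_charge g * d / e) * G_charge g = g / e * d" for d e
    using h_charge_pos(3)[OF g] by (simp add: field_simps)
  ultimately show ?thesis
    unfolding E_factor_def by (simp only:)
qed

text \<open>The factor B cancels the denominator in E', and the term g b q' of B' cancels the one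
  coming from E'. Since q^2 + b^2 = s, what remains is E (s' + 2 g q b').\<close>

lemma DERIV_B_E_factor:
  assumes g: "-2 < g" "g < 2"
    and q: "(q has_real_derivative q') (at t)" and b: "(b has_real_derivative b') (at t)"
    and pos: "q t > 0"
  shows "((\<lambda>t. finsleroid_B g (q t) (b t) * E_factor g (q t) (b t)) has_real_derivative
           2 * E_factor g (q t) (b t) * (q t * q' + (b t + g * q t) * b')) (at t)"
proof -
  let ?B = "finsleroid_B g (q t) (b t)" and ?E = "E_factor g (q t) (b t)"
  have B: "((\<lambda>t. finsleroid_B g (q t) (b t)) has_real_derivative
      2 * b t * b' + g * (q' * b t + q t * b') + 2 * q t * q') (at t)"
    unfolding finsleroid_B_def
    by (auto intro!: derivative_eq_intros q b simp: algebra_simps)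
  have nz: "?B \<noteq> 0" using finsleroid_B_pos[OF g pos, of "b t"] by simp
  have *: "(2 * b t * b' + g * (q' * b t + q t * b') + 2 * q t * q') * ?E
      + (?E * (g / ?B * (q t * b' - b t * q'))) * ?B
      = 2 * ?E * (q t * q' + (b t + g * q t) * b')"
    using nz by (simp add: field_simps)
  show ?thesis
    using DERIV_mult[OF B DERIV_E_factor[OF g q b pos]] unfolding * .
qed

subsection \<open>The Finsleroid metric tensor\<close>


lemma b_scalar_eq_inner: "b_scalar w y = w \<bullet> y"
  by (simp add: b_scalar_def inner_vec_def)

lemma inner_mult_vector: "x \<bullet> (\<alpha> *v y) = (\<Sum>i\<in>UNIV. \<Sum>j\<in>UNIV. \<alpha> $ i $ j * x $ i * y $ j)"
  for x y :: "real^'n::finite"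
  by (simp add: inner_vec_def matrix_vector_mult_def sum_distrib_left ac_simps)

lemma q_scalar_eq: "q_scalar \<alpha> w y = sqrt (y \<bullet> (\<alpha> *v y) - (w \<bullet> y)\<^sup>2)"
proof -
  have "(w \<bullet> y)\<^sup>2 = (\<Sum>i\<in>UNIV. \<Sum>j\<in>UNIV. w $ i * w $ j * y $ i * y $ j)"
    unfolding power2_eq_square inner_vec_def sum_product
    by (simp add: ac_simps)
  then show ?thesis
    by (simp add: q_scalar_def inner_mult_vector left_diff_distrib sum_subtractf)
qed

lemma raise_eq: "raise \<alpha> w i = (matrix_inv \<alpha> *v w) $ i"
  by (simp add: raise_def matrix_vector_mult_def)

lemma norm_sq_eq: "norm_sq \<alpha> w = w \<bullet> (matrix_inv \<alpha> *v w)"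
  by (simp add: norm_sq_def inner_mult_vector)

lemma v_vec_eq: "v_vec \<alpha> w y i = (y - (w \<bullet> y) *\<^sub>R (matrix_inv \<alpha> *v w)) $ i"
  by (simp add: v_vec_def b_scalar_eq_inner raise_eq)

lemma inner_symmetric_matrix:
  fixes \<alpha> :: "real^'n::finite^'n"
  assumes "transpose \<alpha> = \<alpha>"
  shows "x \<bullet> (\<alpha> *v y) = (\<alpha> *v x) \<bullet> y"
  by (metis assms dot_lmul_matrix matrix_transpose_mul transpose_matrix_vector)

lemma symmetric_matrix_nth:
  assumes "transpose \<alpha> = \<alpha>"
  shows "\<alpha> $ i $ j = \<alpha> $ j $ i"
  using arg_cong[OF assms, of "\<lambda>m. m $ j $ i"] by (simp add: transpose_def)

lemma finsleroid_K_squared: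
  assumes "-2 < g" "g < 2" "q_scalar \<alpha> w y > 0"
  shows "(finsleroid_K g \<alpha> w y)\<^sup>2 = finsleroid_B g (q_scalar \<alpha> w y) (w \<bullet> y)
           * E_factor g (q_scalar \<alpha> w y) (w \<bullet> y)"
  using finsleroid_B_pos[OF assms, of "w \<bullet> y"]
  by (simp add: finsleroid_K_def Let_def power_mult_distrib b_scalar_eq_inner E_factor_def
      exp_double[symmetric])

text \<open>Closed form of the Finslerian metric tensor. For invertible \<open>\<alpha>\<close>, its
  \<open>v\<close> is \<open>v_vec\<close> with the index lowered; when \<open>w\<close> has unit
  length it annihilates the raised \<open>w\<close>. The correction to \<open>\<alpha>\<close>
  involves only \<open>w\<close> and \<open>v\<close>, which later reduces everything to two scalar
  unknowns.\<close>

definition finsleroid_tensor :: "real \<Rightarrow> real^'n^'n \<Rightarrow> real^'n \<Rightarrow> real^'n \<Rightarrow> real^'n::finite^'n" where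
  "finsleroid_tensor g \<alpha> w y =
     (let b = w \<bullet> y; q = q_scalar \<alpha> w y; v = \<alpha> *v y - b *\<^sub>R w in
      \<chi> i j. E_factor g q b * (\<alpha> $ i $ j + g / (q * finsleroid_B g q b) *
        (q\<^sup>2 * (w $ i * v $ j + v $ i * w $ j) + q\<^sup>2 * (b + g * q) * (w $ i * w $ j)
          - b * (v $ i * v $ j))))"

text \<open>All three arguments may move along the curve, so that the same rule serves for
  y-derivatives, where only \<open>y\<close> varies, and for x-derivatives, where only
  \<open>\<alpha>\<close> and \<open>w\<close> vary.\<close>

lemma DERIV_q_scalar:
  assumes s: "((\<lambda>t. y t \<bullet> (\<alpha> t *v y t)) has_real_derivative s') (at t)"
    and b: "((\<lambda>t. w t \<bullet> y t) has_real_derivative b') (at t)"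
    and pos: "q_scalar (\<alpha> t) (w t) (y t) > 0"
  shows "((\<lambda>t. q_scalar (\<alpha> t) (w t) (y t)) has_real_derivative
            (s'/2 - (w t \<bullet> y t) * b') / q_scalar (\<alpha> t) (w t) (y t)) (at t)"
proof -
  have "y t \<bullet> (\<alpha> t *v y t) - (w t \<bullet> y t)\<^sup>2 > 0" using pos by (simp add: q_scalar_eq)
  then show ?thesis
    unfolding q_scalar_eq
    by (auto intro!: derivative_eq_intros s b simp: field_simps)
qed

lemma eventually_pos:
  assumes "(f has_real_derivative D) (at t)" "f t > 0"
  shows "\<forall>\<^sub>F s in nhds t. f s > 0"
  using DERIV_isCont[OF assms(1)] assms(2)
  by (metis isCont_def tendsto_at_iff_tendsto_nhds order_tendstoD(1))

lemma partial_eqI: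
  assumes "((\<lambda>t. f (x + t *\<^sub>R axis i 1)) has_real_derivative D) (at 0)"
  shows "partial i f x = D"
  unfolding partial_def by (rule DERIV_imp_deriv[OF assms])

lemma matrix_vector_axis_nth: "(\<alpha> *v axis i 1) $ j = \<alpha> $ j $ i" for \<alpha> :: "real^'n::finite^'n"
  by (simp add: matrix_vector_mul_component inner_axis)

lemma DERIV_line:
  fixes \<alpha> :: "real^'n::finite^'n"
  assumes sym: "transpose \<alpha> = \<alpha>"
  shows "((\<lambda>t. (y + t *\<^sub>R axis i 1) \<bullet> (\<alpha> *v (y + t *\<^sub>R axis i 1)))
           has_real_derivative 2 * (\<alpha> *v y) $ i) (at 0)" (is ?A)
    and "((\<lambda>t. w \<bullet> (y + t *\<^sub>R axis i 1)) has_real_derivative w $ i) (at 0)" (is ?B)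
    and "((\<lambda>t. (\<alpha> *v (y + t *\<^sub>R axis i 1)) $ j) has_real_derivative \<alpha> $ j $ i) (at 0)" (is ?C)
proof -
  let ?e = "axis i 1 :: real^'n"
  have "(y + t *\<^sub>R ?e) \<bullet> (\<alpha> *v (y + t *\<^sub>R ?e)) =
     y \<bullet> (\<alpha> *v y) + t * (2 * (\<alpha> *v y) $ i) + t\<^sup>2 * (\<alpha> $ i $ i)" for t
  proof -
    have "y \<bullet> (\<alpha> *v ?e) = (\<alpha> *v y) $ i"
      by (simp add: inner_symmetric_matrix[OF sym] inner_axis)
    moreover have "?e \<bullet> (\<alpha> *v y) = (\<alpha> *v y) $ i" "?e \<bullet> (\<alpha> *v ?e) = \<alpha> $ i $ i"
      by (simp_all add: inner_axis' matrix_vector_axis_nth)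
    ultimately show ?thesis
      by (simp add: matrix_vector_right_distrib matrix_vector_mult_scaleR inner_add_left inner_add_right
          power2_eq_square algebra_simps)
  qed
  then show ?A by (auto intro!: derivative_eq_intros)
  show ?B by (auto intro!: derivative_eq_intros simp: inner_add_right inner_axis)
  show ?C
    by (auto intro!: derivative_eq_intros
        simp: matrix_vector_right_distrib matrix_vector_mult_scaleR matrix_vector_axis_nth)
qed

lemma partial_finsleroid_K_squared:
  assumes g: "-2 < g" "g < 2" and sym: "transpose \<alpha> = \<alpha>" and pos: "q_scalar \<alpha> w y > 0"
  shows "partial j (\<lambda>z. (finsleroid_K g \<alpha> w z)\<^sup>2) y =
    2 * E_factor g (q_scalar \<alpha> w y) (w \<bullet> y) * ((\<alpha> *v y) $ j + g * q_scalar \<alpha> w y * w $ j)"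
proof (rule partial_eqI)
  let ?y = "\<lambda>t::real. y + t *\<^sub>R axis j 1"
  let ?q = "\<lambda>t. q_scalar \<alpha> w (?y t)"
  have pos0: "?q 0 > 0" using pos by simp
  note q = DERIV_q_scalar[of ?y "\<lambda>_. \<alpha>" _ _ "\<lambda>_. w", OF DERIV_line(1,2)[OF sym] pos0]
  have ev: "\<forall>\<^sub>F t in nhds 0. (finsleroid_K g \<alpha> w (?y t))\<^sup>2
      = finsleroid_B g (?q t) (w \<bullet> ?y t) * E_factor g (?q t) (w \<bullet> ?y t)"
    using eventually_pos[OF q pos0] by eventually_elim (rule finsleroid_K_squared[OF g])
  have "((\<lambda>t. finsleroid_B g (?q t) (w \<bullet> ?y t) * E_factor g (?q t) (w \<bullet> ?y t)) has_real_derivative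
      2 * E_factor g (q_scalar \<alpha> w y) (w \<bullet> y) * ((\<alpha> *v y) $ j + g * q_scalar \<alpha> w y * w $ j)) (at 0)"
    by (rule DERIV_cong[OF DERIV_B_E_factor[OF g q DERIV_line(2)[OF sym] pos0]])
       (use pos in \<open>simp add: field_simps\<close>)
  then show "((\<lambda>t. (finsleroid_K g \<alpha> w (?y t))\<^sup>2) has_real_derivative
      2 * E_factor g (q_scalar \<alpha> w y) (w \<bullet> y) * ((\<alpha> *v y) $ j + g * q_scalar \<alpha> w y * w $ j)) (at 0)"
    using DERIV_cong_ev[OF refl ev refl] by simp
qed

lemma finsler_metric_finsleroid:
  assumes g: "-2 < g" "g < 2" and sym: "transpose (\<alpha> x) = \<alpha> x" and pos: "q_scalar (\<alpha> x) (w x) y > 0"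
  shows "finsler_metric (\<lambda>z. finsleroid_K g (\<alpha> z) (w z)) x y = finsleroid_tensor g (\<alpha> x) (w x) y"
proof -
  have "1/2 * partial i (partial j (\<lambda>z. (finsleroid_K g (\<alpha> x) (w x) z)\<^sup>2)) y
          = finsleroid_tensor g (\<alpha> x) (w x) y $ i $ j" for i j
  proof -
    let ?\<alpha> = "\<alpha> x" and ?w = "w x"
    let ?y = "\<lambda>t::real. y + t *\<^sub>R axis i 1"
    let ?q = "\<lambda>t. q_scalar ?\<alpha> ?w (?y t)"
    let ?p = "\<lambda>t. 2 * E_factor g (?q t) (?w \<bullet> ?y t) * ((?\<alpha> *v ?y t) $ j + g * ?q t * ?w $ j)"
    have pos0: "?q 0 > 0" using pos by simp
    note q = DERIV_q_scalar[of ?y "\<lambda>_. ?\<alpha>" _ _ "\<lambda>_. ?w", OF DERIV_line(1,2)[OF sym] pos0]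
    have ev: "\<forall>\<^sub>F t in nhds 0. partial j (\<lambda>z. (finsleroid_K g ?\<alpha> ?w z)\<^sup>2) (?y t) = ?p t"
      using eventually_pos[OF q pos0]
      by eventually_elim (rule partial_finsleroid_K_squared[OF g sym])
    have nz: "finsleroid_B g (q_scalar ?\<alpha> ?w y) (?w \<bullet> y) \<noteq> 0"
      using finsleroid_B_pos[OF g pos, of "?w \<bullet> y"] by simp
    have aij: "?\<alpha> $ i $ j = ?\<alpha> $ j $ i" by (rule symmetric_matrix_nth[OF sym])
    have "(?p has_real_derivative 2 * finsleroid_tensor g ?\<alpha> ?w y $ i $ j) (at 0)"
    proof -
      define q0 where "q0 = q_scalar ?\<alpha> ?w y"
      define b0 where "b0 = ?w \<bullet> y"
      define Y where "Y = ?\<alpha> *v y"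
      have qp: "q0 > 0" using pos q0_def by simp
      define B0 where "B0 = finsleroid_B g q0 b0"
      have BB: "B0 = q0\<^sup>2 + b0\<^sup>2 + g * q0 * b0" by (simp add: finsleroid_B_def B0_def)
      define E0 where "E0 = E_factor g q0 b0"
      have E: "((\<lambda>t. E_factor g (?q t) (?w \<bullet> ?y t)) has_real_derivative
          E0 * (g / B0 * (q0 * ?w $ i - b0 * ((Y $ i - b0 * ?w $ i) / q0)))) (at 0)"
        using DERIV_E_factor[OF g q DERIV_line(2)[OF sym] pos0]
        by (simp add: q0_def b0_def B0_def E0_def Y_def)
      have q': "(?q has_real_derivative (Y $ i - b0 * ?w $ i) / q0) (at 0)"
        using q by (simp add: q0_def b0_def Y_def)
      have "(?p has_real_derivative
         2 * (E0 * (g / B0 * (q0 * ?w $ i - b0 * ((Y $ i - b0 * ?w $ i) / q0)))) *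
           (Y $ j + g * q0 * ?w $ j)
         + 2 * E0 * (?\<alpha> $ j $ i + g * ((Y $ i - b0 * ?w $ i) / q0) * ?w $ j)) (at 0)"
        using DERIV_mult[OF DERIV_cmult[OF E, of 2]
            DERIV_add[OF DERIV_line(3)[OF sym, of y i j] DERIV_cmult_right[OF DERIV_cmult[OF q', of g], of "?w $ j"]]]
        by (simp add: q0_def b0_def E0_def Y_def mult.commute mult.left_commute)
      moreover have "2 * (E0 * (g / B0 * (q0 * ?w $ i - b0 * ((Y $ i - b0 * ?w $ i) / q0)))) *
           (Y $ j + g * q0 * ?w $ j)
         + 2 * E0 * (?\<alpha> $ j $ i + g * ((Y $ i - b0 * ?w $ i) / q0) * ?w $ j)
         = 2 * finsleroid_tensor g ?\<alpha> ?w y $ i $ j"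
      proof -
        \<comment> \<open>Substituting Y = v + b w exposes the symmetry in i and j: the coefficient
          of v_i w_j becomes B - b (b + g q) = q^2, the same as that of w_i v_j.\<close>
        have *: "g / B0 * (q0 * wi - b0 * ((Yi - b0 * wi) / q0)) * (Yj + g * q0 * wj)
           + g * ((Yi - b0 * wi) / q0) * wj = g / (q0 * B0) * (q0\<^sup>2 * (wi * (Yj - b0 * wj) + (Yi - b0 * wi) * wj)
              + q0\<^sup>2 * (b0 + g * q0) * (wi * wj) - b0 * ((Yi - b0 * wi) * (Yj - b0 * wj)))"
          for wi wj Yi Yj :: real
        proof -
          have "B0 \<noteq> 0" using nz by (simp add: B0_def q0_def b0_def)
          moreover have "g * (q0 * (q0 * wi) - b0 * (Yi - b0 * wi)) * (Yj + g * q0 * wj)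
               + g * (Yi - b0 * wi) * wj * B0 = g * (q0\<^sup>2 * (wi * (Yj - b0 * wj) + (Yi - b0 * wi) * wj)
              + q0\<^sup>2 * (b0 + g * q0) * (wi * wj) - b0 * ((Yi - b0 * wi) * (Yj - b0 * wj)))"
            unfolding BB by (simp add: power2_eq_square algebra_simps)
          moreover have "g / B0 * (q0 * wi - b0 * (z / q0)) * p + g * (z / q0) * wj
              = (g * (q0 * (q0 * wi) - b0 * z) * p + g * z * wj * B0) / (q0 * B0)" if "B0 \<noteq> 0" for z p
            using that qp by (simp add: field_simps)
          ultimately show ?thesis by simp
        qed
        have "finsleroid_tensor g ?\<alpha> ?w y $ i $ j = E0 * (?\<alpha> $ i $ j + g / (q0 * B0) * (q0\<^sup>2 * (?w$i * (Y$j - b0 * ?w$j) + (Y$i - b0 * ?w$i) * ?w$j)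
              + q0\<^sup>2 * (b0 + g * q0) * (?w$i * ?w$j) - b0 * ((Y$i - b0 * ?w$i) * (Y$j - b0 * ?w$j))))"
          by (simp add: finsleroid_tensor_def Let_def q0_def b0_def B0_def E0_def Y_def)
        moreover have "2 * (E0 * r) * s + 2 * E0 * (d + u) = 2 * (E0 * (d + (r * s + u)))" for r s d u
          by (simp add: algebra_simps)
        ultimately show ?thesis by (simp only: * aij)
      qed
      ultimately show ?thesis by simp
    qed
    then have "((\<lambda>t. partial j (\<lambda>z. (finsleroid_K g ?\<alpha> ?w z)\<^sup>2) (?y t)) has_real_derivative
        2 * finsleroid_tensor g ?\<alpha> ?w y $ i $ j) (at 0)"
      using DERIV_cong_ev[OF refl ev refl] by simp
    then show ?thesis using partial_eqI by fastforce
  qed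
  then show ?thesis by (simp add: finsler_metric_def vec_eq_iff)
qed

subsection \<open>Contracted Christoffel symbols\<close>


definition partial_vec :: "'n::finite \<Rightarrow> (real^'n \<Rightarrow> real^'n) \<Rightarrow> real^'n \<Rightarrow> real^'n" where
  "partial_vec m w x = (\<chi> i. partial m (\<lambda>z. w z $ i) x)"

definition partial_mat :: "'n::finite \<Rightarrow> (real^'n \<Rightarrow> real^'n^'n) \<Rightarrow> real^'n \<Rightarrow> real^'n^'n" where
  "partial_mat m A x = (\<chi> i j. partial m (\<lambda>z. A z $ i $ j) x)"

text \<open>The Christoffel symbols of the first kind, contracted twice with \<open>y\<close>. The
  derivative matrices occur only through their products with \<open>y\<close>.\<close>

definition christoffel_lower :: "(real^'n \<Rightarrow> real^'n^'n) \<Rightarrow> real^'n::finite \<Rightarrow> real^'n \<Rightarrow> real^'n" where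
  "christoffel_lower A x y = (\<Sum>m\<in>UNIV. y $ m *\<^sub>R (partial_mat m A x *v y))
     - (1/2) *\<^sub>R (\<chi> k. y \<bullet> (partial_mat k A x *v y))"

text \<open>The covector f_kn y^n, that is, the exterior derivative of \<open>w\<close> with
  \<open>y\<close> in its second slot.\<close>

definition curl_vec :: "(real^'n \<Rightarrow> real^'n) \<Rightarrow> real^'n::finite \<Rightarrow> real^'n \<Rightarrow> real^'n" where
  "curl_vec w x y = (\<chi> k. partial_vec k w x \<bullet> y) - (\<Sum>m\<in>UNIV. y $ m *\<^sub>R partial_vec m w x)"

text \<open>Contracting both lower slots with the same vector makes the first two derivative terms
  equal, by renaming summation indices. The field \<open>A\<close> is arbitrary, so the lemma covers
  the Riemannian metric as well as the Finslerian one with \<open>y\<close> frozen.\<close>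

lemma christoffel_contract:
  "(\<Sum>n\<in>UNIV. \<Sum>m\<in>UNIV. christoffel A x i n m * y $ n * y $ m)
     = (matrix_inv (A x) *v christoffel_lower A x y) $ i"
proof -
  define d where "d m i j = partial m (\<lambda>z. A z $ i $ j) x" for m i j
  define I where "I k = matrix_inv (A x) $ i $ k" for k
  have "(\<Sum>n\<in>UNIV. \<Sum>m\<in>UNIV. christoffel A x i n m * y $ n * y $ m)
     = (\<Sum>n\<in>UNIV. \<Sum>m\<in>UNIV. \<Sum>k\<in>UNIV. I k * (1/2 * (d m k n + d n k m - d k m n) * y $ n * y $ m))"
    by (simp add: christoffel_def d_def I_def sum_distrib_left sum_distrib_right ac_simps)
  also have "\<dots> = (\<Sum>n\<in>UNIV. \<Sum>k\<in>UNIV. \<Sum>m\<in>UNIV. I k * (1/2 * (d m k n + d n k m - d k m n) * y $ n * y $ m))"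
    by (intro sum.cong refl sum.swap)
  also have "\<dots> = (\<Sum>k\<in>UNIV. \<Sum>n\<in>UNIV. \<Sum>m\<in>UNIV. I k * (1/2 * (d m k n + d n k m - d k m n) * y $ n * y $ m))"
    by (rule sum.swap)
  also have "\<dots> = (\<Sum>k\<in>UNIV. I k * (\<Sum>n\<in>UNIV. \<Sum>m\<in>UNIV. 1/2 * (d m k n + d n k m - d k m n) * y $ n * y $ m))"
    by (simp add: sum_distrib_left)
  also have "\<dots> = (\<Sum>k\<in>UNIV. I k * christoffel_lower A x y $ k)"
  proof (rule sum.cong[OF refl])
    fix k
    have "(\<Sum>n\<in>UNIV. \<Sum>m\<in>UNIV. 1/2 * (d m k n + d n k m - d k m n) * y $ n * y $ m)
       = (1/2) * (\<Sum>n\<in>UNIV. \<Sum>m\<in>UNIV. d m k n * y $ n * y $ m)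
       + (1/2) * (\<Sum>n\<in>UNIV. \<Sum>m\<in>UNIV. d n k m * y $ n * y $ m)
       - (1/2) * (\<Sum>n\<in>UNIV. \<Sum>m\<in>UNIV. d k m n * y $ n * y $ m)"
      by (simp add: sum_distrib_left sum.distrib sum_subtractf algebra_simps add_divide_distrib diff_divide_distrib)
    also have "(\<Sum>n\<in>UNIV. \<Sum>m\<in>UNIV. d m k n * y $ n * y $ m) = (\<Sum>n\<in>UNIV. \<Sum>m\<in>UNIV. d n k m * y $ n * y $ m)"
      by (subst sum.swap) (simp add: ac_simps)
    also have "(\<Sum>n\<in>UNIV. \<Sum>m\<in>UNIV. d k m n * y $ n * y $ m) = (\<Sum>n\<in>UNIV. \<Sum>m\<in>UNIV. d k n m * y $ n * y $ m)"
      by (subst sum.swap) (simp add: ac_simps)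
    finally have "(\<Sum>n\<in>UNIV. \<Sum>m\<in>UNIV. 1/2 * (d m k n + d n k m - d k m n) * y $ n * y $ m)
       = (\<Sum>n\<in>UNIV. \<Sum>m\<in>UNIV. d n k m * y $ n * y $ m) - (1/2) * (\<Sum>n\<in>UNIV. \<Sum>m\<in>UNIV. d k n m * y $ n * y $ m)"
      by simp
    also have "\<dots> = christoffel_lower A x y $ k"
      unfolding christoffel_lower_def inner_mult_vector
      by (simp add: partial_mat_def d_def matrix_vector_mult_def sum_distrib_left ac_simps)
    finally show "I k * (\<Sum>n\<in>UNIV. \<Sum>m\<in>UNIV. 1/2 * (d m k n + d n k m - d k m n) * y $ n * y $ m)
        = I k * christoffel_lower A x y $ k" by simp
  qed
  finally show ?thesis by (simp add: matrix_vector_mult_def I_def)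
qed

lemma spray_coeff_eq:
  "spray_coeff K x y i = (matrix_inv (finsler_metric K x y)
      *v christoffel_lower (\<lambda>z. finsler_metric K z y) x y) $ i"
  unfolding spray_coeff_def finsler_christoffel_def by (rule christoffel_contract)

section \<open>Pointwise linear algebra of the Finsleroid metric tensor\<close>

lemma finsleroid_tensor_mult:
  assumes "b = w \<bullet> y" "q = q_scalar \<alpha> w y" "v = \<alpha> *v y - b *\<^sub>R w"
  shows "finsleroid_tensor g \<alpha> w y *v z = E_factor g q b *\<^sub>R (\<alpha> *v z + (g / (q * finsleroid_B g q b)) *\<^sub>R
     ((q\<^sup>2 * (v \<bullet> z) + q\<^sup>2 * (b + g * q) * (w \<bullet> z)) *\<^sub>R w + (q\<^sup>2 * (w \<bullet> z) - b * (v \<bullet> z)) *\<^sub>R v))"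
proof -
  define c where "c = g / (q * finsleroid_B g q b)"
  have "finsleroid_tensor g \<alpha> w y $ i $ j * z $ j = E_factor g q b * (\<alpha> $ i $ j * z $ j + c *
     ((q\<^sup>2 * (v $ j * z $ j) + q\<^sup>2 * (b + g * q) * (w $ j * z $ j)) * w $ i
     + (q\<^sup>2 * (w $ j * z $ j) - b * (v $ j * z $ j)) * v $ i))" for i j
    unfolding finsleroid_tensor_def Let_def assms[symmetric] c_def[symmetric]
    by (simp add: algebra_simps)
  then show ?thesis
    by (simp add: vec_eq_iff matrix_vector_mult_def c_def[symmetric] inner_vec_def
        sum_distrib_left sum_distrib_right sum.distrib sum_subtractf distrib_left right_diff_distrib
        distrib_right left_diff_distrib mult.assoc)
qed

text \<open>With \<open>v\<close> . \<open>y\<close> = q^2 and \<open>w\<close> . \<open>y\<close> =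
  b the component along \<open>v\<close> cancels, and the one along \<open>w\<close> becomes q^2 B,
  which removes the denominator. The result is half the y-gradient of K^2, as Euler's theorem on
  homogeneous functions predicts.\<close>

lemma finsleroid_tensor_mult_self:
  assumes g: "-2 < g" "g < 2" and pos: "q_scalar \<alpha> w y > 0"
  shows "finsleroid_tensor g \<alpha> w y *v y = E_factor g (q_scalar \<alpha> w y) (w \<bullet> y) *\<^sub>R
     (\<alpha> *v y + (g * q_scalar \<alpha> w y) *\<^sub>R w)"
proof -
  define b where "b = w \<bullet> y"
  define q where "q = q_scalar \<alpha> w y"
  define v where "v = \<alpha> *v y - b *\<^sub>R w"
  define B where "B = finsleroid_B g q b"
  have qp: "q > 0" using pos by (simp add: q_def)
  have q2: "q\<^sup>2 = y \<bullet> (\<alpha> *v y) - b\<^sup>2"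
    using pos by (simp add: q_scalar_eq q_def b_def)
  have Bp: "B > 0" using finsleroid_B_pos[OF g qp] by (simp add: B_def)
  have "y \<bullet> w = b" by (simp add: b_def inner_commute)
  then have vy: "v \<bullet> y = q\<^sup>2"
    unfolding q2 v_def inner_commute[of _ y] by (simp add: inner_diff_right power2_eq_square)
  have "q\<^sup>2 * (v \<bullet> y) + q\<^sup>2 * (b + g * q) * (w \<bullet> y) = q\<^sup>2 * B"
    unfolding vy B_def finsleroid_B_def b_def[symmetric] by (simp add: power2_eq_square algebra_simps)
  moreover have "q\<^sup>2 * (w \<bullet> y) - b * (v \<bullet> y) = 0"
    unfolding vy b_def[symmetric] by simp
  moreover have "g / (q * B) * (q\<^sup>2 * B) = g * q"
    using qp Bp by (simp add: power2_eq_square)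
  ultimately show ?thesis
    unfolding finsleroid_tensor_mult[OF b_def q_def v_def] B_def[symmetric] q_def[symmetric]
      b_def[symmetric]
    by (simp only: scaleR_zero_left add_0_right scaleR_scaleR)
qed

lemma invertible_if_ker_trivial:
  fixes A :: "real^'n::finite^'n"
  assumes "\<And>x. A *v x = 0 \<Longrightarrow> x = 0"
  shows "invertible A"
  using assms by (simp add: invertible_left_inverse matrix_left_invertible_ker)

lemma matrix_inv_mult:
  assumes "invertible A"
  shows "A ** matrix_inv A = mat 1" "matrix_inv A ** A = mat 1"
proof -
  have "A ** matrix_inv A = mat 1 \<and> matrix_inv A ** A = mat 1"
    using assms unfolding invertible_def matrix_inv_def by (rule someI_ex)
  then show "A ** matrix_inv A = mat 1" "matrix_inv A ** A = mat 1" by auto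
qed

lemma matrix_inv_mult_cancel:
  fixes A :: "real^'n::finite^'n"
  assumes "invertible A"
  shows "matrix_inv A *v (A *v x) = x" "A *v (matrix_inv A *v x) = x"
  using assms by (simp_all add: matrix_vector_mul_assoc matrix_inv_mult)

text \<open>Contracting \<open>T z = 0\<close> with \<open>u\<close> and with \<open>y - b u\<close> gives a linear \<open>2 \<times> 2\<close> system for
  \<open>w \<bullet> z\<close> and \<open>v \<bullet> z\<close> whose determinant is \<open>B\<^sup>2\<close>.\<close>

lemma invertible_finsleroid_tensor:
  fixes \<alpha> :: "real^'n::finite^'n"
  assumes g: "-2 < g" "g < 2" and pos: "q_scalar \<alpha> w y > 0"
    and sym: "transpose \<alpha> = \<alpha>" and inv: "invertible \<alpha>"
    and u: "\<alpha> *v u = w" and unit: "w \<bullet> u = 1"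
  shows "invertible (finsleroid_tensor g \<alpha> w y)"
proof (rule invertible_if_ker_trivial)
  fix z assume z: "finsleroid_tensor g \<alpha> w y *v z = 0"
  define b where "b = w \<bullet> y"
  define q where "q = q_scalar \<alpha> w y"
  define v where "v = \<alpha> *v y - b *\<^sub>R w"
  define B where "B = finsleroid_B g q b"
  have qp: "q > 0" using pos by (simp add: q_def)
  have q2: "y \<bullet> (\<alpha> *v y) = q\<^sup>2 + b\<^sup>2"
    using pos by (simp add: q_scalar_eq q_def b_def)
  have Bp: "B > 0" using finsleroid_B_pos[OF g qp] by (simp add: B_def)
  have BB: "B = b\<^sup>2 + g * q * b + q\<^sup>2" by (simp add: B_def finsleroid_B_def)
  define s t where "s = w \<bullet> z" and "t = v \<bullet> z"
  define c where "c = g / (q * B)"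
  have gc: "g = c * q * B" using qp Bp by (simp add: c_def)
  have 0: "\<alpha> *v z + c *\<^sub>R ((q\<^sup>2 * t + q\<^sup>2 * (b + g * q) * s) *\<^sub>R w + (q\<^sup>2 * s - b * t) *\<^sub>R v) = 0"
    using z unfolding finsleroid_tensor_mult[OF b_def q_def v_def] s_def t_def c_def B_def
    by (simp add: E_factor_def)
  have uY: "u \<bullet> (\<alpha> *v x) = w \<bullet> x" for x
    by (simp add: inner_symmetric_matrix[OF sym] u)
  have uw: "u \<bullet> w = 1" using unit by (simp add: inner_commute)
  have uv: "u \<bullet> v = 0" by (simp add: v_def inner_diff_right uY uw b_def)
  have yw: "y \<bullet> w = b" by (simp add: b_def inner_commute)
  have yv: "y \<bullet> v = q\<^sup>2" by (simp add: v_def inner_diff_right q2 yw power2_eq_square)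
  have yz: "y \<bullet> (\<alpha> *v z) = t + b * s"
    by (simp add: inner_symmetric_matrix[OF sym] t_def v_def inner_diff_left s_def)
  have 1: "s + c * (q\<^sup>2 * t + q\<^sup>2 * (b + g * q) * s) = 0"
    using arg_cong[OF 0, of "\<lambda>x. u \<bullet> x"] by (simp add: inner_add_right uY uv uw s_def)
  have "t + b * s + c * ((q\<^sup>2 * t + q\<^sup>2 * (b + g * q) * s) * b + (q\<^sup>2 * s - b * t) * q\<^sup>2) = 0"
    using arg_cong[OF 0, of "\<lambda>x. y \<bullet> x"] by (simp add: inner_add_right yw yv yz)
  then have 2: "t + c * (q\<^sup>2 * s - b * t) * q\<^sup>2 = 0"
    using 1 by algebra
  have 3: "(B + g * q * (b + g * q)) * s + g * q * t = 0"
    using arg_cong[OF 1, of "\<lambda>x. B * x"] gc by algebra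
  have 4: "(B - g * q * b) * t + g * q^3 * s = 0"
    using arg_cong[OF 2, of "\<lambda>x. B * x"] gc by algebra
  \<comment> \<open>The determinant expands to B^2 + g^2 q^2 (B - b^2 - g q b - q^2), and the
    bracket vanishes by \<open>BB\<close>.\<close>
  have "B\<^sup>2 * s = 0" using 3 4 BB by algebra
  moreover have "B\<^sup>2 * t = 0" using 3 4 BB by algebra
  ultimately have "s = 0" "t = 0" using Bp by auto
  with 0 have "\<alpha> *v z = 0" by simp
  then show "z = 0" using matrix_inv_mult_cancel(1)[OF inv, of z] by simp
qed

text \<open>The heart of the verification, freed from calculus: \<open>\<Gamma>\<close> stands for
  the Riemannian spray, \<open>\<phi>\<close> for f^i, and \<open>\<beta>\<close>,
  \<open>\<kappa>\<close> for the two contractions of nabla b. The right-hand side is the lowered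
  Finslerian spray. The \<open>f\<close> and \<open>L\<close> terms match at once, so only the
  coefficients of \<open>w\<close> and \<open>v\<close> have to be compared.\<close>

lemma finsleroid_tensor_spray:
  fixes \<alpha> :: "real^'n::finite^'n"
  assumes g: "-2 < g" "g < 2" and pos: "q_scalar \<alpha> w y > 0"
    and sym: "transpose \<alpha> = \<alpha>"
    and u: "\<alpha> *v u = w" and unit: "w \<bullet> u = 1"
    and b_def: "b = w \<bullet> y" and q_def: "q = q_scalar \<alpha> w y"
    and B_def: "B = finsleroid_B g q b"
    and \<Gamma>: "\<alpha> *v \<Gamma> = L" and \<phi>: "\<alpha> *v \<phi> = f" and yf: "y \<bullet> f = 0" and uf: "u \<bullet> f = \<kappa>"
    and Db: "Db = \<beta> + w \<bullet> \<Gamma>" and Dq: "Dq = (y \<bullet> L - b * Db) / q"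
  shows "finsleroid_tensor g \<alpha> w y *v
      ((g * (1 / q * \<beta> + g * \<kappa>)) *\<^sub>R (y - b *\<^sub>R u) - (g * q) *\<^sub>R \<phi> + \<Gamma>)
    = E_factor g q b *\<^sub>R ((g / B * (q * Db - b * Dq)) *\<^sub>R (\<alpha> *v y + (g * q) *\<^sub>R w) + L
         + (g * Dq) *\<^sub>R w - (g * q) *\<^sub>R f)" (is "_ *v ?X = _")
proof -
  define v where "v = \<alpha> *v y - b *\<^sub>R w"
  have qp: "q > 0" using pos by (simp add: q_def)
  have q2: "y \<bullet> (\<alpha> *v y) = q\<^sup>2 + b\<^sup>2"
    using pos by (simp add: q_scalar_eq q_def b_def)
  have Bp: "B > 0" using finsleroid_B_pos[OF g qp] by (simp add: B_def)
  have BB: "B = b\<^sup>2 + g * q * b + q\<^sup>2" by (simp add: B_def finsleroid_B_def)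
  define c where "c = g * (1 / q * \<beta> + g * \<kappa>)"
  define G0 where "G0 = w \<bullet> \<Gamma>"
  define L0 where "L0 = y \<bullet> L"
  have w\<phi>: "w \<bullet> \<phi> = \<kappa>"
    by (metis u inner_symmetric_matrix[OF sym] \<phi> uf)
  have wX: "w \<bullet> ?X = G0 - g * q * \<kappa>"
    by (simp add: inner_add_right inner_diff_right unit b_def[symmetric] w\<phi> G0_def)
  have AX: "\<alpha> *v ?X = c *\<^sub>R v - (g * q) *\<^sub>R f + L"
    by (simp add: matrix_vector_right_distrib matrix_vector_mult_diff_distrib matrix_vector_mult_scaleR
        v_def u \<Gamma> \<phi> c_def)
  have yw: "y \<bullet> w = b" by (simp add: b_def inner_commute)
  have yv: "y \<bullet> v = q\<^sup>2" by (simp add: v_def inner_diff_right q2 yw power2_eq_square)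
  have "v \<bullet> ?X = y \<bullet> (\<alpha> *v ?X) - b * (w \<bullet> ?X)"
    unfolding inner_symmetric_matrix[OF sym] v_def inner_diff_left by simp
  then have vX: "v \<bullet> ?X = c * q\<^sup>2 + L0 - b * (G0 - g * q * \<kappa>)"
    unfolding AX wX by (simp add: inner_add_right inner_diff_right yv yf L0_def)
  define e where "e = g / (q * B)"
  have eg: "g = e * q * B" using qp Bp by (simp add: e_def)
  have Y: "\<alpha> *v y = v + b *\<^sub>R w" by (simp add: v_def)
  have gB: "g / B = e * q" using qp by (simp add: e_def)
  have Dq': "q * Dq = L0 - b * Db" using Dq qp by (simp add: L0_def)
  have c': "q * c = g * (\<beta> + g * q * \<kappa>)" using qp by (simp add: c_def field_simps)
  have Db': "Db = \<beta> + G0" by (simp add: Db G0_def)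
  have w_coeff: "e * (q\<^sup>2 * (v \<bullet> ?X) + q\<^sup>2 * (b + g * q) * (w \<bullet> ?X))
       = g / B * (q * Db - b * Dq) * (b + g * q) + g * Dq"
  proof -
    have "q * (e * (q\<^sup>2 * (v \<bullet> ?X) + q\<^sup>2 * (b + g * q) * (w \<bullet> ?X)))
       = q * (g / B * (q * Db - b * Dq) * (b + g * q) + g * Dq)"
      unfolding vX wX gB using Dq' c' Db' eg BB by algebra
    then show ?thesis using qp mult_left_cancel[of q] by blast
  qed
  \<comment> \<open>Here 1 - e b q^2 = (q^2 + b^2) / B. Hence the part g^2 \<open>\<kappa>\<close>
    of \<open>c\<close> contributes exactly what cancels the \<open>\<kappa>\<close> terms brought
    in by \<open>\<phi>\<close>, and the part g \<open>\<beta>\<close> / q supplies the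
    \<open>\<beta>\<close> inside \<open>Db\<close>.\<close>
  have v_coeff: "c + e * (q\<^sup>2 * (w \<bullet> ?X) - b * (v \<bullet> ?X)) = g / B * (q * Db - b * Dq)"
  proof -
    have "q * (c + e * (q\<^sup>2 * (w \<bullet> ?X) - b * (v \<bullet> ?X))) = q * (g / B * (q * Db - b * Dq))"
      unfolding vX wX gB using Dq' c' Db' eg BB by algebra
    then show ?thesis using qp mult_left_cancel[of q] by blast
  qed
  have "\<alpha> *v ?X + e *\<^sub>R ((q\<^sup>2 * (v \<bullet> ?X) + q\<^sup>2 * (b + g * q) * (w \<bullet> ?X)) *\<^sub>R w
         + (q\<^sup>2 * (w \<bullet> ?X) - b * (v \<bullet> ?X)) *\<^sub>R v)
     = (e * (q\<^sup>2 * (v \<bullet> ?X) + q\<^sup>2 * (b + g * q) * (w \<bullet> ?X))) *\<^sub>R w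
       + (c + e * (q\<^sup>2 * (w \<bullet> ?X) - b * (v \<bullet> ?X))) *\<^sub>R v - (g * q) *\<^sub>R f + L"
    unfolding AX by (simp add: algebra_simps)
  also have "\<dots> = (g / B * (q * Db - b * Dq)) *\<^sub>R (\<alpha> *v y + (g * q) *\<^sub>R w) + L
         + (g * Dq) *\<^sub>R w - (g * q) *\<^sub>R f"
  proof -
    have "(p * (b + g * q) + r) *\<^sub>R w + p *\<^sub>R v - (g * q) *\<^sub>R f + L
        = p *\<^sub>R (v + b *\<^sub>R w + (g * q) *\<^sub>R w) + L + r *\<^sub>R w - (g * q) *\<^sub>R f" for p r
      by (simp add: algebra_simps)
    then show ?thesis unfolding w_coeff v_coeff Y .
  qed
  finally show ?thesis
    unfolding finsleroid_tensor_mult[OF b_def q_def v_def] e_def B_def by simp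
qed


section \<open>Derivatives of the metric tensor along coordinate lines\<close>

text \<open>\<open>partial\<close> is defined through \<open>deriv\<close>, which carries
  information only where a derivative exists; differentiability of the field provides it.\<close>

lemma DERIV_partial:
  assumes "f differentiable (at x)"
  shows "((\<lambda>t. f (x + t *\<^sub>R axis m 1)) has_real_derivative partial m f x) (at 0)"
proof -
  have "(\<lambda>t::real. x + t *\<^sub>R axis m 1) differentiable (at 0)" by (auto intro!: derivative_intros)
  then have "(f \<circ> (\<lambda>t. x + t *\<^sub>R axis m 1)) differentiable (at 0)"
    using assms by (intro differentiable_chain_at) auto
  then have "(\<lambda>t. f (x + t *\<^sub>R axis m 1)) field_differentiable (at 0)"
    by (simp add: o_def real_differentiable_def field_differentiable_def)
  then show ?thesis unfolding partial_def by (simp add: DERIV_deriv_iff_field_differentiable)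
qed

lemma eventually_line:
  fixes x :: "real^'n::finite"
  assumes "open U" "x \<in> U"
  shows "\<forall>\<^sub>F t in nhds 0. x + t *\<^sub>R axis m 1 \<in> U"
proof -
  have "((\<lambda>t::real. x + t *\<^sub>R axis m 1) \<longlongrightarrow> x + 0 *\<^sub>R axis m 1) (nhds 0)"
    by (intro tendsto_intros) (rule filterlim_ident)
  then show ?thesis using topological_tendstoD[OF _ assms(1), of _ x] assms(2) by auto
qed

lemma partial_cong:
  assumes "open U" "x \<in> U" "\<And>z. z \<in> U \<Longrightarrow> f z = f' z"
  shows "partial m f x = partial m f' x"
  unfolding partial_def
  using eventually_mono[OF eventually_line[OF assms(1,2)] assms(3)]
  by (intro deriv_cong_ev) auto

lemma DERIV_fields:
  fixes \<alpha> :: "real^'n::finite \<Rightarrow> real^'n^'n" and w :: "real^'n \<Rightarrow> real^'n"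
  shows "(\<And>i j. (\<lambda>z. \<alpha> z $ i $ j) differentiable (at x)) \<Longrightarrow>
      ((\<lambda>t. (\<alpha> (x + t *\<^sub>R axis m 1) *v y) $ k) has_real_derivative (partial_mat m \<alpha> x *v y) $ k) (at 0)"
    and "(\<And>i j. (\<lambda>z. \<alpha> z $ i $ j) differentiable (at x)) \<Longrightarrow>
      ((\<lambda>t. y \<bullet> (\<alpha> (x + t *\<^sub>R axis m 1) *v y)) has_real_derivative y \<bullet> (partial_mat m \<alpha> x *v y)) (at 0)"
    and "(\<And>i. (\<lambda>z. w z $ i) differentiable (at x)) \<Longrightarrow>
      ((\<lambda>t. w (x + t *\<^sub>R axis m 1) \<bullet> y) has_real_derivative partial_vec m w x \<bullet> y) (at 0)"
proof -
  show 1: "((\<lambda>t. (\<alpha> (x + t *\<^sub>R axis m 1) *v y) $ k) has_real_derivative (partial_mat m \<alpha> x *v y) $ k) (at 0)"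
    if "\<And>i j. (\<lambda>z. \<alpha> z $ i $ j) differentiable (at x)" for k
    unfolding matrix_vector_mult_def partial_mat_def
    by (auto intro!: derivative_eq_intros DERIV_sum DERIV_partial that)
  show "((\<lambda>t. y \<bullet> (\<alpha> (x + t *\<^sub>R axis m 1) *v y)) has_real_derivative y \<bullet> (partial_mat m \<alpha> x *v y)) (at 0)"
    if "\<And>i j. (\<lambda>z. \<alpha> z $ i $ j) differentiable (at x)"
    unfolding inner_vec_def inner_real_def
    by (intro DERIV_sum) (auto intro!: derivative_eq_intros 1[OF that])
  show "((\<lambda>t. w (x + t *\<^sub>R axis m 1) \<bullet> y) has_real_derivative partial_vec m w x \<bullet> y) (at 0)"
    if "\<And>i. (\<lambda>z. w z $ i) differentiable (at x)"
    unfolding inner_vec_def inner_real_def partial_vec_def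
    by (intro DERIV_sum) (auto intro!: derivative_eq_intros DERIV_partial that)
qed

text \<open>Because \<open>y\<close> is constant in x, the product of the differentiated tensor with
  \<open>y\<close> is the derivative of the covector in \<open>finsleroid_tensor_mult_self\<close>.
  \<open>bm\<close> and \<open>qm\<close> are the derivatives of b and q in the direction m.\<close>

lemma partial_mat_finsler_metric_mult:
  fixes \<alpha> :: "real^'n::finite \<Rightarrow> real^'n^'n" and w :: "real^'n \<Rightarrow> real^'n"
  assumes g: "-2 < g" "g < 2" and U: "open U" "x \<in> U"
    and sym: "\<And>z. z \<in> U \<Longrightarrow> transpose (\<alpha> z) = \<alpha> z"
    and d\<alpha>: "\<And>i j. (\<lambda>z. \<alpha> z $ i $ j) differentiable (at x)"
    and dw: "\<And>i. (\<lambda>z. w z $ i) differentiable (at x)"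
    and pos: "q_scalar (\<alpha> x) (w x) y > 0"
    and b_def: "b = w x \<bullet> y" and q_def: "q = q_scalar (\<alpha> x) (w x) y"
    and B_def: "B = finsleroid_B g q b"
    and bm_def: "bm = partial_vec m w x \<bullet> y"
    and qm_def: "qm = ((y \<bullet> (partial_mat m \<alpha> x *v y)) / 2 - b * bm) / q"
  shows "partial_mat m (\<lambda>z. finsler_metric (\<lambda>z. finsleroid_K g (\<alpha> z) (w z)) z y) x *v y
    = E_factor g q b *\<^sub>R ((g / B * (q * bm - b * qm)) *\<^sub>R (\<alpha> x *v y + (g * q) *\<^sub>R w x)
        + partial_mat m \<alpha> x *v y + (g * qm) *\<^sub>R w x + (g * q) *\<^sub>R partial_vec m w x)"
proof -
  define F where "F z = finsler_metric (\<lambda>z. finsleroid_K g (\<alpha> z) (w z)) z y" for z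
  let ?l = "\<lambda>t::real. x + t *\<^sub>R axis m 1"
  let ?\<alpha> = "\<lambda>t. \<alpha> (?l t)" and ?w = "\<lambda>t. w (?l t)"
  let ?q = "\<lambda>t. q_scalar (?\<alpha> t) (?w t) y"
  have pos0: "?q 0 > 0" using pos by simp
  note b = DERIV_fields(3)[OF dw, of m y]
  have q: "(?q has_real_derivative qm) (at 0)"
    using DERIV_q_scalar[OF DERIV_fields(2)[OF d\<alpha>] b pos0] by (simp add: qm_def bm_def b_def q_def)
  note E = DERIV_E_factor[OF g q b pos0]
  have nz: "finsleroid_B g (?q 0) (?w 0 \<bullet> y) \<noteq> 0" using finsleroid_B_pos[OF g pos0, of "?w 0 \<bullet> y"] by simp
  have B: "(\<lambda>t. finsleroid_B g (?q t) (?w t \<bullet> y)) field_differentiable (at 0)"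
  proof -
    have "?q field_differentiable (at 0)" "(\<lambda>t. ?w t \<bullet> y) field_differentiable (at 0)"
      using b q by (auto simp: field_differentiable_def)
    then show ?thesis unfolding finsleroid_B_def by (auto intro!: derivative_intros)
  qed
  have evq: "\<forall>\<^sub>F t in nhds 0. ?q t > 0" by (rule eventually_pos[OF q pos0])
  have ev: "\<forall>\<^sub>F t in nhds 0. F (?l t) = finsleroid_tensor g (?\<alpha> t) (?w t) y"
    using evq eventually_line[OF U] unfolding F_def
    by eventually_elim (rule finsler_metric_finsleroid[OF g sym])
  have w: "((\<lambda>t. ?w t $ k) has_real_derivative partial_vec m w x $ k) (at 0)" for k
    using DERIV_partial[OF dw] by (simp add: partial_vec_def)
  \<comment> \<open>Existence of the derivative of each entry is what allows \<open>partial\<close>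
    to be pulled out of the sum over the components of \<open>y\<close>; its value is left
    implicit.\<close>
  have T: "(\<lambda>t. finsleroid_tensor g (?\<alpha> t) (?w t) y $ k $ n) field_differentiable (at 0)" for k n
  proof -
    have "(\<lambda>t. E_factor g (?q t) (?w t \<bullet> y)) field_differentiable (at 0)"
      using E by (auto simp: field_differentiable_def)
    moreover have "?q field_differentiable (at 0)" "(\<lambda>t. ?w t \<bullet> y) field_differentiable (at 0)"
      "(\<lambda>t. ?\<alpha> t $ k $ n) field_differentiable (at 0)"
      using b q DERIV_partial[OF d\<alpha>] by (auto simp: field_differentiable_def)
    moreover have "(\<lambda>t. (?\<alpha> t *v y) $ k) field_differentiable (at 0)"
      "(\<lambda>t. ?w t $ k) field_differentiable (at 0)" for k
      using DERIV_fields(1)[OF d\<alpha>] w unfolding field_differentiable_def by blast+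
    ultimately show ?thesis
      unfolding finsleroid_tensor_def Let_def using B nz pos
      by (auto intro!: derivative_intros)
  qed
  have F: "((\<lambda>t. F (?l t) $ k $ n) has_real_derivative partial m (\<lambda>z. F z $ k $ n) x) (at 0)" for k n
  proof -
    have ev': "\<forall>\<^sub>F t in nhds 0. F (?l t) $ k $ n = finsleroid_tensor g (?\<alpha> t) (?w t) y $ k $ n"
      using ev by eventually_elim simp
    obtain D where "((\<lambda>t. finsleroid_tensor g (?\<alpha> t) (?w t) y $ k $ n) has_real_derivative D) (at 0)"
      using T[of k n] unfolding field_differentiable_def by blast
    then have D: "((\<lambda>t. F (?l t) $ k $ n) has_real_derivative D) (at 0)"
      using DERIV_cong_ev[OF refl ev' refl] by simp
    then show ?thesis using partial_eqI[OF D] by simp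
  qed
  have "(partial_mat m F x *v y) $ k
    = (E_factor g q b *\<^sub>R ((g / B * (q * bm - b * qm)) *\<^sub>R (\<alpha> x *v y + (g * q) *\<^sub>R w x)
        + partial_mat m \<alpha> x *v y + (g * qm) *\<^sub>R w x + (g * q) *\<^sub>R partial_vec m w x)) $ k" (is "_ = ?R $ k") for k
  proof -
    have 1: "((\<lambda>t. (F (?l t) *v y) $ k) has_real_derivative (partial_mat m F x *v y) $ k) (at 0)"
      unfolding matrix_vector_mult_def partial_mat_def
      by (auto intro!: derivative_eq_intros DERIV_sum F)
    have ev2: "\<forall>\<^sub>F t in nhds 0. (F (?l t) *v y) $ k = E_factor g (?q t) (?w t \<bullet> y) *
        ((?\<alpha> t *v y) $ k + g * ?q t * ?w t $ k)"
      using ev evq by eventually_elim (simp add: finsleroid_tensor_mult_self[OF g])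
    have "((\<lambda>t. E_factor g (?q t) (?w t \<bullet> y) * ((?\<alpha> t *v y) $ k + g * ?q t * ?w t $ k))
        has_real_derivative ?R $ k) (at 0)"
    proof -
      define c where "c = g / B * (q * bm - b * qm)"
      have "((\<lambda>t. E_factor g (?q t) (?w t \<bullet> y)) has_real_derivative E_factor g q b * c) (at 0)"
        using E by (simp add: c_def b_def q_def B_def bm_def)
      from DERIV_mult[OF this DERIV_add[OF DERIV_fields(1)[OF d\<alpha>, of m y k]
          DERIV_mult[OF DERIV_cmult[OF q, of g] w[of k]]]]
      show ?thesis
        unfolding c_def[symmetric] by (rule DERIV_cong) (simp add: algebra_simps b_def q_def)
    qed
    then have "((\<lambda>t. (F (?l t) *v y) $ k) has_real_derivative ?R $ k) (at 0)"
      using DERIV_cong_ev[OF refl ev2 refl] by simp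
    then show ?thesis using DERIV_unique 1 by blast
  qed
  then show ?thesis unfolding F_def[symmetric] by (simp add: vec_eq_iff)
qed

lemma inner_vec_lambda: "(\<Sum>m\<in>UNIV. y $ m * c m) = y \<bullet> (\<chi> m. c m)"
  by (simp add: inner_vec_def)

text \<open>Contracting the preceding lemma with y^m turns \<open>bm\<close>, \<open>qm\<close> into
  \<open>Db\<close>, \<open>Dq\<close>. The term g q y^m d_m w_k then meets -g q (d_k w) . y from
  half the gradient of K^2, and together they form -g q times the curl.\<close>

lemma christoffel_lower_finsler_metric:
  fixes \<alpha> :: "real^'n::finite \<Rightarrow> real^'n^'n" and w :: "real^'n \<Rightarrow> real^'n"
  assumes g: "-2 < g" "g < 2" and U: "open U" "x \<in> U"
    and sym: "\<And>z. z \<in> U \<Longrightarrow> transpose (\<alpha> z) = \<alpha> z"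
    and d\<alpha>: "\<And>i j. (\<lambda>z. \<alpha> z $ i $ j) differentiable (at x)"
    and dw: "\<And>i. (\<lambda>z. w z $ i) differentiable (at x)"
    and pos: "q_scalar (\<alpha> x) (w x) y > 0"
    and b_def: "b = w x \<bullet> y" and q_def: "q = q_scalar (\<alpha> x) (w x) y"
    and B_def: "B = finsleroid_B g q b"
    and L_def: "L = christoffel_lower \<alpha> x y"
    and Db_def: "Db = (\<Sum>m\<in>UNIV. y $ m * (partial_vec m w x \<bullet> y))"
    and Dq_def: "Dq = (y \<bullet> L - b * Db) / q"
  shows "christoffel_lower (\<lambda>z. finsler_metric (\<lambda>z. finsleroid_K g (\<alpha> z) (w z)) z y) x y
    = E_factor g q b *\<^sub>R ((g / B * (q * Db - b * Dq)) *\<^sub>R (\<alpha> x *v y + (g * q) *\<^sub>R w x) + L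
         + (g * Dq) *\<^sub>R w x - (g * q) *\<^sub>R curl_vec w x y)"
proof -
  define E where "E = E_factor g q b"
  define F where "F z = finsler_metric (\<lambda>z. finsleroid_K g (\<alpha> z) (w z)) z y" for z
  define bm where "bm m = partial_vec m w x \<bullet> y" for m
  define sm where "sm m = y \<bullet> (partial_mat m \<alpha> x *v y)" for m
  define qm where "qm m = (sm m / 2 - b * bm m) / q" for m
  define cm where "cm m = g / B * (q * bm m - b * qm m)" for m
  define P where "P = \<alpha> x *v y + (g * q) *\<^sub>R w x"
  have qp: "q > 0" using pos by (simp add: q_def)
  have Bp: "B > 0" using finsleroid_B_pos[OF g qp] by (simp add: B_def)
  have q2: "y \<bullet> (\<alpha> x *v y) = q\<^sup>2 + b\<^sup>2"
    using pos by (simp add: q_scalar_eq q_def b_def)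
  have yw: "y \<bullet> w x = b" by (simp add: b_def inner_commute)
  have yP: "y \<bullet> P = B"
    by (simp add: P_def inner_add_right q2 yw B_def finsleroid_B_def)
  have D: "partial_mat m F x *v y = E *\<^sub>R (cm m *\<^sub>R P + partial_mat m \<alpha> x *v y
      + (g * qm m) *\<^sub>R w x + (g * q) *\<^sub>R partial_vec m w x)" for m
    unfolding E_def cm_def P_def F_def
    by (rule partial_mat_finsler_metric_mult[OF g U sym d\<alpha> dw pos b_def q_def B_def bm_def])
       (simp_all add: qm_def sm_def)
  \<comment> \<open>This is the x-derivative of K^2 at fixed \<open>y\<close>. It loses its
    denominator because \<open>y\<close> . \<open>P\<close> = B, and the terms in \<open>qm\<close>
    cancel.\<close>
  have yD: "y \<bullet> (partial_mat k F x *v y) = E * (sm k + 2 * (g * q) * bm k)" for k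
  proof -
    have "cm k * B = g * (q * bm k - b * qm k)" using Bp by (simp add: cm_def)
    moreover have "y \<bullet> (partial_mat k F x *v y)
        = E * (cm k * B + sm k + g * qm k * b + g * q * bm k)"
      unfolding D
      by (simp add: inner_add_right yP yw sm_def bm_def inner_commute[of _ y] flip: P_def)
    ultimately show ?thesis by (simp add: algebra_simps)
  qed
  have sum_s: "(\<Sum>m\<in>UNIV. y $ m * sm m) = 2 * (y \<bullet> L)"
  proof -
    have "y \<bullet> L = (\<Sum>m\<in>UNIV. y $ m * sm m) - 1/2 * (\<Sum>m\<in>UNIV. y $ m * sm m)"
      unfolding L_def christoffel_lower_def inner_vec_lambda
      by (simp add: inner_diff_right inner_sum_right sm_def inner_vec_lambda)
    then show ?thesis by simp
  qed
  have sum_b: "(\<Sum>m\<in>UNIV. y $ m * bm m) = Db" by (simp add: Db_def bm_def)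
  have sum_q: "(\<Sum>m\<in>UNIV. y $ m * qm m) = Dq"
  proof -
    have "(\<Sum>m\<in>UNIV. y $ m * qm m) = ((\<Sum>m\<in>UNIV. y $ m * sm m) / 2 - b * (\<Sum>m\<in>UNIV. y $ m * bm m)) / q"
    proof -
      have "y $ m * qm m = ((y $ m * sm m) / 2 - b * (y $ m * bm m)) / q" for m
        using qp by (simp add: qm_def field_simps)
      then have "(\<Sum>m\<in>UNIV. y $ m * qm m) = (\<Sum>m\<in>UNIV. ((y $ m * sm m) / 2 - b * (y $ m * bm m)) / q)"
        by simp
      also have "\<dots> = ((\<Sum>m\<in>UNIV. y $ m * sm m) / 2 - b * (\<Sum>m\<in>UNIV. y $ m * bm m)) / q"
        unfolding sum_divide_distrib[symmetric] sum_subtractf sum_distrib_left[symmetric] ..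
      finally show ?thesis .
    qed
    then show ?thesis by (simp add: sum_s sum_b Dq_def)
  qed
  have sum_c: "(\<Sum>m\<in>UNIV. y $ m * cm m) = g / B * (q * Db - b * Dq)"
    unfolding cm_def sum_b[symmetric] sum_q[symmetric]
    by (simp add: sum_subtractf sum_distrib_left algebra_simps diff_divide_distrib sum_divide_distrib)
  have "christoffel_lower F x y $ k = (E *\<^sub>R ((g / B * (q * Db - b * Dq)) *\<^sub>R P + L
         + (g * Dq) *\<^sub>R w x - (g * q) *\<^sub>R curl_vec w x y)) $ k" for k
  proof -
    have "christoffel_lower F x y $ k = E * ((\<Sum>m\<in>UNIV. y $ m * cm m) * P $ k
        + (\<Sum>m\<in>UNIV. y $ m * (partial_mat m \<alpha> x *v y) $ k) + g * (\<Sum>m\<in>UNIV. y $ m * qm m) * w x $ k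
        + g * q * (\<Sum>m\<in>UNIV. y $ m * partial_vec m w x $ k)) - 1/2 * (E * (sm k + 2 * (g * q) * bm k))"
      unfolding christoffel_lower_def yD[symmetric] unfolding D
      by (simp add: sum_distrib_left sum_distrib_right sum.distrib distrib_left algebra_simps)
    then show ?thesis
      unfolding sum_c sum_q L_def christoffel_lower_def curl_vec_def
      by (simp add: sm_def bm_def algebra_simps)
  qed
  then show ?thesis unfolding F_def[symmetric] E_def P_def by (simp add: vec_eq_iff)
qed

subsection \<open>Covariant derivatives of a unit form\<close>


text \<open>The difference of the two sides is the squared length of the part of \<open>x\<close>
  orthogonal to \<open>u\<close>. It makes the radicand of q nonnegative and drives the minimum
  argument in \<open>partial_unit\<close>.\<close>

lemma inner_sq_le:
  fixes \<alpha> :: "real^'n::finite^'n"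
  assumes sym: "transpose \<alpha> = \<alpha>" and pd: "\<And>y. y \<noteq> 0 \<Longrightarrow> y \<bullet> (\<alpha> *v y) > 0"
    and u: "\<alpha> *v u = w" and unit: "w \<bullet> u = 1"
  shows "(w \<bullet> x)\<^sup>2 \<le> x \<bullet> (\<alpha> *v x)"
proof -
  define z where "z = x - (w \<bullet> x) *\<^sub>R u"
  have "0 \<le> z \<bullet> (\<alpha> *v z)" using pd[of z] by (cases "z = 0") auto
  also have "z \<bullet> (\<alpha> *v z) = x \<bullet> (\<alpha> *v x) - (w \<bullet> x)\<^sup>2"
  proof -
    have "u \<bullet> (\<alpha> *v x) = w \<bullet> x" by (simp add: inner_symmetric_matrix[OF sym] u)
    moreover have "x \<bullet> w = w \<bullet> x" "u \<bullet> w = 1" using unit by (simp_all add: inner_commute)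
    ultimately show ?thesis
      by (simp add: z_def matrix_vector_mult_diff_distrib matrix_vector_mult_scaleR u
          inner_diff_left inner_diff_right power2_eq_square algebra_simps)
  qed
  finally show ?thesis by simp
qed

lemma invertible_if_positive_definite:
  fixes \<alpha> :: "real^'n::finite^'n"
  assumes "\<And>y. y \<noteq> 0 \<Longrightarrow> y \<bullet> (\<alpha> *v y) > 0"
  shows "invertible \<alpha>"
  by (rule invertible_if_ker_trivial) (metis assms inner_zero_right less_irrefl)

lemma curl_vec_orthogonal: "y \<bullet> curl_vec w x y = 0"
proof -
  have "y \<bullet> (\<Sum>m\<in>UNIV. y $ m *\<^sub>R partial_vec m w x) = (\<Sum>m\<in>UNIV. y $ m * (partial_vec m w x \<bullet> y))"
    by (simp add: inner_sum_right inner_commute)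
  then show ?thesis
    by (simp add: curl_vec_def inner_diff_right inner_vec_lambda)
qed

text \<open>One coordinate domain; the identity is proved in each chart separately. Unit length is
  required throughout the open set because its derivative is used.\<close>

locale unit_form_domain =
  fixes U :: "(real^'n::finite) set" and \<alpha> :: "real^'n \<Rightarrow> real^'n^'n" and w :: "real^'n \<Rightarrow> real^'n"
  assumes open_U: "open U"
    and sym: "\<And>z. z \<in> U \<Longrightarrow> transpose (\<alpha> z) = \<alpha> z"
    and pos_def: "\<And>z y. z \<in> U \<Longrightarrow> y \<noteq> 0 \<Longrightarrow> y \<bullet> (\<alpha> z *v y) > 0"
    and unit: "\<And>z. z \<in> U \<Longrightarrow> w z \<bullet> (matrix_inv (\<alpha> z) *v w z) = 1"
    and diff_\<alpha>: "\<And>z i j. z \<in> U \<Longrightarrow> (\<lambda>z. \<alpha> z $ i $ j) differentiable (at z)"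
    and diff_w: "\<And>z i. z \<in> U \<Longrightarrow> (\<lambda>z. w z $ i) differentiable (at z)"
begin

definition sharp :: "real^'n \<Rightarrow> real^'n" where
  "sharp z = matrix_inv (\<alpha> z) *v w z"

lemma inv: "z \<in> U \<Longrightarrow> invertible (\<alpha> z)"
  by (rule invertible_if_positive_definite[OF pos_def])

lemma mult_sharp: "z \<in> U \<Longrightarrow> \<alpha> z *v sharp z = w z"
  unfolding sharp_def by (rule matrix_inv_mult_cancel(2)[OF inv])

lemma unit_sharp: "z \<in> U \<Longrightarrow> w z \<bullet> sharp z = 1"
  unfolding sharp_def by (rule unit)

lemma inner_matrix_inv: "z \<in> U \<Longrightarrow> w z \<bullet> (matrix_inv (\<alpha> z) *v x) = sharp z \<bullet> x"
  by (metis mult_sharp inner_symmetric_matrix[OF sym] matrix_inv_mult_cancel(2)[OF inv])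

lemma partial_sym:
  assumes "x \<in> U"
  shows "partial n (\<lambda>z. \<alpha> z $ i $ j) x = partial n (\<lambda>z. \<alpha> z $ j $ i) x"
  by (rule partial_cong[OF open_U assms]) (rule symmetric_matrix_nth[OF sym])

text \<open>The inverse matrix is moved from the Christoffel symbol onto \<open>w\<close>, which
  leaves symbols of the first kind contracted with \<open>sharp x\<close>.\<close>

lemma nabla_eq:
  assumes x: "x \<in> U"
  shows "nabla \<alpha> w x j h = partial_vec j w x $ h - 1/2 * (\<Sum>n\<in>UNIV. sharp x $ n *
     (partial_mat h \<alpha> x $ n $ j + partial_mat j \<alpha> x $ n $ h - partial_mat n \<alpha> x $ h $ j))"
proof -
  define X :: "real^'n" where "X = (\<chi> n. partial_mat h \<alpha> x $ n $ j + partial_mat j \<alpha> x $ n $ h - partial_mat n \<alpha> x $ h $ j)"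
  have "christoffel \<alpha> x k j h = 1/2 * (matrix_inv (\<alpha> x) *v X) $ k" for k
    by (simp add: christoffel_def X_def partial_mat_def matrix_vector_mult_def)
  then have "(\<Sum>k\<in>UNIV. christoffel \<alpha> x k j h * w x $ k) = 1/2 * (w x \<bullet> (matrix_inv (\<alpha> x) *v X))"
    by (simp only: inner_vec_def inner_real_def sum_distrib_left ac_simps)
  also have "\<dots> = 1/2 * (\<Sum>n\<in>UNIV. sharp x $ n * X $ n)"
    unfolding inner_matrix_inv[OF x] by (simp add: inner_vec_def)
  finally show ?thesis by (simp add: nabla_def partial_vec_def X_def)
qed

text \<open>The function \<open>z \<mapsto> \<alpha>\<^sub>z(u, u) - (w\<^sub>z \<bullet> u)\<^sup>2\<close> with \<open>u\<close> frozen at \<open>sharp x\<close> is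
  nonnegative and vanishes at \<open>x\<close>; being critical there, it yields the derivative of the unit
  length condition without differentiating the inverse matrix.\<close>

lemma partial_unit:
  assumes x: "x \<in> U"
  shows "sharp x \<bullet> (partial_mat n \<alpha> x *v sharp x) = 2 * (partial_vec n w x \<bullet> sharp x)"
proof -
  let ?u = "sharp x"
  let ?l = "\<lambda>t::real. x + t *\<^sub>R axis n 1"
  let ?f = "\<lambda>t. ?u \<bullet> (\<alpha> (?l t) *v ?u) - (w (?l t) \<bullet> ?u)\<^sup>2"
  have f0: "?f 0 = 0"
    using unit_sharp[OF x] by (simp add: mult_sharp[OF x] inner_commute)
  have D: "(?f has_real_derivative ?u \<bullet> (partial_mat n \<alpha> x *v ?u) - 2 * (partial_vec n w x \<bullet> ?u)) (at 0)"
    using unit_sharp[OF x]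
    by (auto intro!: derivative_eq_intros DERIV_fields(2)[OF diff_\<alpha>[OF x]] DERIV_fields(3)[OF diff_w[OF x]])
  have "\<forall>\<^sub>F t in nhds 0. ?f t \<ge> 0"
    using eventually_line[OF open_U x]
    by eventually_elim (use inner_sq_le[OF sym pos_def mult_sharp unit_sharp] in auto)
  then obtain d where "d > 0" "\<And>t. dist t 0 < d \<Longrightarrow> ?f t \<ge> 0"
    unfolding eventually_nhds_metric by auto
  then have "?u \<bullet> (partial_mat n \<alpha> x *v ?u) - 2 * (partial_vec n w x \<bullet> ?u) = 0"
    using DERIV_local_min[OF D, of d] f0 by (auto simp: dist_real_def)
  then show ?thesis by simp
qed

text \<open>Contracted with \<open>sharp x\<close> in both slots, the first and third derivative
  terms cancel. What is left is half the derivative of the unit length condition, supplied by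
  \<open>partial_unit\<close>.\<close>

lemma nabla_sharp:
  assumes x: "x \<in> U"
  shows "(\<Sum>h\<in>UNIV. sharp x $ h * nabla \<alpha> w x j h) = 0"
proof -
  let ?u = "\<lambda>i. sharp x $ i" and ?d = "\<lambda>m i j. partial_mat m \<alpha> x $ i $ j"
  have "(\<Sum>h\<in>UNIV. ?u h * nabla \<alpha> w x j h) = (\<Sum>h\<in>UNIV. ?u h * partial_vec j w x $ h)
     - 1/2 * ((\<Sum>h\<in>UNIV. \<Sum>n\<in>UNIV. ?d h n j * ?u h * ?u n) + (\<Sum>h\<in>UNIV. \<Sum>n\<in>UNIV. ?d j n h * ?u h * ?u n)
        - (\<Sum>h\<in>UNIV. \<Sum>n\<in>UNIV. ?d n h j * ?u h * ?u n))"
    unfolding nabla_eq[OF x]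
    by (simp add: algebra_simps sum.distrib sum_subtractf sum_distrib_left sum_divide_distrib)
  also have "(\<Sum>h\<in>UNIV. \<Sum>n\<in>UNIV. ?d h n j * ?u h * ?u n) = (\<Sum>h\<in>UNIV. \<Sum>n\<in>UNIV. ?d n h j * ?u h * ?u n)"
    by (subst sum.swap) (simp add: ac_simps)
  also have "(\<Sum>h\<in>UNIV. \<Sum>n\<in>UNIV. ?d j n h * ?u h * ?u n) = sharp x \<bullet> (partial_mat j \<alpha> x *v sharp x)"
    unfolding inner_mult_vector by (subst sum.swap) (simp add: ac_simps)
  also have "(\<Sum>h\<in>UNIV. ?u h * partial_vec j w x $ h) = partial_vec j w x \<bullet> sharp x"
    by (simp add: inner_vec_def ac_simps)
  finally show ?thesis using partial_unit[OF x, of j] by simp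
qed

lemma f_lower_eq:
  assumes x: "x \<in> U"
  shows "f_lower \<alpha> w x k n = partial_vec k w x $ n - partial_vec n w x $ k"
proof -
  have "partial_mat m \<alpha> x $ i $ j = partial_mat m \<alpha> x $ j $ i" for m i j
    by (simp add: partial_mat_def partial_sym[OF x, of m i j])
  then show ?thesis unfolding f_lower_def nabla_eq[OF x] by (simp add: add.commute)
qed

lemma f_lower_contract:
  assumes x: "x \<in> U"
  shows "(\<Sum>n\<in>UNIV. f_lower \<alpha> w x k n * y $ n) = curl_vec w x y $ k"
  unfolding f_lower_eq[OF x]
  by (simp add: curl_vec_def inner_vec_def algebra_simps sum_subtractf)

lemma f_vec_eq:
  assumes x: "x \<in> U"
  shows "f_vec \<alpha> w x y i = (matrix_inv (\<alpha> x) *v curl_vec w x y) $ i"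
proof -
  have "f_vec \<alpha> w x y i = (\<Sum>k\<in>UNIV. matrix_inv (\<alpha> x) $ i $ k * (\<Sum>n\<in>UNIV. f_lower \<alpha> w x k n * y $ n))"
    unfolding f_vec_def f_mixed_def sum_distrib_left sum_distrib_right
    by (subst sum.swap) (simp add: ac_simps)
  then show ?thesis by (simp add: f_lower_contract[OF x] matrix_vector_mult_def)
qed

text \<open>Of the two halves of f_jh, the one with \<open>sharp x\<close> contracted into the form
  index vanishes by \<open>nabla_sharp\<close>. This produces the scalar y^h b^j nabla_j b_h of the
  theorem.\<close>

lemma sharp_curl_vec:
  assumes x: "x \<in> U"
  shows "sharp x \<bullet> curl_vec w x y = (\<Sum>h\<in>UNIV. \<Sum>j\<in>UNIV. y $ h * sharp x $ j * nabla \<alpha> w x j h)"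
proof -
  have "sharp x \<bullet> curl_vec w x y = (\<Sum>j\<in>UNIV. \<Sum>h\<in>UNIV. y $ h * sharp x $ j * f_lower \<alpha> w x j h)"
    by (simp add: inner_vec_def sum_distrib_left ac_simps flip: f_lower_contract[OF x])
  also have "\<dots> = (\<Sum>h\<in>UNIV. \<Sum>j\<in>UNIV. y $ h * sharp x $ j * f_lower \<alpha> w x j h)"
    by (rule sum.swap)
  also have "\<dots> = (\<Sum>h\<in>UNIV. \<Sum>j\<in>UNIV. y $ h * sharp x $ j * nabla \<alpha> w x j h)
      - (\<Sum>h\<in>UNIV. y $ h * (\<Sum>j\<in>UNIV. sharp x $ j * nabla \<alpha> w x h j))"
    by (simp add: f_lower_def right_diff_distrib sum_subtractf sum_distrib_left ac_simps)
  finally show ?thesis by (simp add: nabla_sharp[OF x])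
qed

text \<open>Separates the derivative of b along \<open>y\<close> from the Riemannian spray, giving
  the relation \<open>Db = \<beta> + w x \<bullet> \<Gamma>\<close> used below.\<close>

lemma nabla_contract:
  "(\<Sum>j\<in>UNIV. \<Sum>h\<in>UNIV. y $ j * y $ h * nabla \<alpha> w x j h)
     = (\<Sum>m\<in>UNIV. y $ m * (partial_vec m w x \<bullet> y)) - w x \<bullet> (matrix_inv (\<alpha> x) *v christoffel_lower \<alpha> x y)"
proof -
  have "w x \<bullet> (matrix_inv (\<alpha> x) *v christoffel_lower \<alpha> x y)
     = (\<Sum>k\<in>UNIV. \<Sum>j\<in>UNIV. \<Sum>h\<in>UNIV. y $ j * y $ h * (christoffel \<alpha> x k j h * w x $ k))"
    unfolding inner_vec_def christoffel_contract[symmetric]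
    by (simp add: sum_distrib_left ac_simps)
  also have "\<dots> = (\<Sum>j\<in>UNIV. \<Sum>k\<in>UNIV. \<Sum>h\<in>UNIV. y $ j * y $ h * (christoffel \<alpha> x k j h * w x $ k))"
    by (rule sum.swap)
  also have "\<dots> = (\<Sum>j\<in>UNIV. \<Sum>h\<in>UNIV. \<Sum>k\<in>UNIV. y $ j * y $ h * (christoffel \<alpha> x k j h * w x $ k))"
    by (intro sum.cong refl sum.swap)
  finally show ?thesis
    by (simp add: nabla_def partial_vec_def inner_vec_def right_diff_distrib sum_subtractf
        sum_distrib_left ac_simps)
qed

section \<open>The spray coefficients in one chart\<close>

lemma spray_coeff_finsleroid:
  assumes g: "-2 < g" "g < 2" and x: "x \<in> U" and nz: "q_scalar (\<alpha> x) (w x) y \<noteq> 0"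
  shows "spray_coeff (\<lambda>z. finsleroid_K g (\<alpha> z) (w z)) x y i
           = g * (1 / q_scalar (\<alpha> x) (w x) y
                    * (\<Sum>j\<in>UNIV. \<Sum>h\<in>UNIV. y $ j * y $ h * nabla \<alpha> w x j h)
                  + g * (\<Sum>h\<in>UNIV. \<Sum>j\<in>UNIV. y $ h * raise (\<alpha> x) (w x) j * nabla \<alpha> w x j h))
               * v_vec (\<alpha> x) (w x) y i
             - g * q_scalar (\<alpha> x) (w x) y * f_vec \<alpha> w x y i
             + (\<Sum>k\<in>UNIV. \<Sum>m\<in>UNIV. christoffel \<alpha> x i k m * y $ k * y $ m)"
proof -
  define L where "L = christoffel_lower \<alpha> x y"
  define Db where "Db = (\<Sum>m\<in>UNIV. y $ m * (partial_vec m w x \<bullet> y))"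
  define \<beta> where "\<beta> = (\<Sum>j\<in>UNIV. \<Sum>h\<in>UNIV. y $ j * y $ h * nabla \<alpha> w x j h)"
  define \<kappa> where "\<kappa> = sharp x \<bullet> curl_vec w x y"
  define \<phi> where "\<phi> = matrix_inv (\<alpha> x) *v curl_vec w x y"
  define \<Gamma> where "\<Gamma> = matrix_inv (\<alpha> x) *v L"
  define q where "q = q_scalar (\<alpha> x) (w x) y"
  define b where "b = w x \<bullet> y"
  define B where "B = finsleroid_B g q b"
  define Dq where "Dq = (y \<bullet> L - b * Db) / q"
  define T where "T = finsleroid_tensor g (\<alpha> x) (w x) y"
  define X where "X = (g * (1 / q * \<beta> + g * \<kappa>)) *\<^sub>R (y - b *\<^sub>R sharp x) - (g * q) *\<^sub>R \<phi> + \<Gamma>"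
  \<comment> \<open>\<open>sqrt\<close> of a negative real is negative in HOL, so q being nonzero
    must be combined with the nonnegativity of its radicand.\<close>
  have pos: "q_scalar (\<alpha> x) (w x) y > 0"
    using nz inner_sq_le[OF sym[OF x] pos_def[OF x] mult_sharp[OF x] unit_sharp[OF x], of y]
    unfolding q_scalar_eq by auto
  have Db: "Db = \<beta> + w x \<bullet> \<Gamma>"
    by (simp add: \<beta>_def nabla_contract \<Gamma>_def L_def Db_def)
  have \<Gamma>: "\<alpha> x *v \<Gamma> = L" and \<phi>: "\<alpha> x *v \<phi> = curl_vec w x y"
    unfolding \<Gamma>_def \<phi>_def by (rule matrix_inv_mult_cancel(2)[OF inv[OF x]])+
  have 1: "christoffel_lower (\<lambda>z. finsler_metric (\<lambda>z. finsleroid_K g (\<alpha> z) (w z)) z y) x y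
    = E_factor g q b *\<^sub>R ((g / B * (q * Db - b * Dq)) *\<^sub>R (\<alpha> x *v y + (g * q) *\<^sub>R w x) + L
         + (g * Dq) *\<^sub>R w x - (g * q) *\<^sub>R curl_vec w x y)"
    by (rule christoffel_lower_finsler_metric[OF g open_U x sym diff_\<alpha>[OF x] diff_w[OF x] pos
        b_def q_def B_def L_def Db_def Dq_def])
  have 2: "T *v X
    = E_factor g q b *\<^sub>R ((g / B * (q * Db - b * Dq)) *\<^sub>R (\<alpha> x *v y + (g * q) *\<^sub>R w x) + L
         + (g * Dq) *\<^sub>R w x - (g * q) *\<^sub>R curl_vec w x y)"
    unfolding T_def X_def
    by (rule finsleroid_tensor_spray[OF g pos sym[OF x] mult_sharp[OF x] unit_sharp[OF x]
        b_def q_def B_def \<Gamma> \<phi> curl_vec_orthogonal \<kappa>_def[symmetric] Db Dq_def])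
  have metric: "finsler_metric (\<lambda>z. finsleroid_K g (\<alpha> z) (w z)) x y = T"
    unfolding T_def by (rule finsler_metric_finsleroid[of g \<alpha> x w y, OF g sym[OF x] pos])
  have "invertible T"
    unfolding T_def
    by (rule invertible_finsleroid_tensor[OF g pos sym[OF x] inv[OF x] mult_sharp[OF x] unit_sharp[OF x]])
  \<comment> \<open>By \<open>1\<close> and \<open>2\<close> the lowered spray is
    \<open>T *v X\<close>, so the inverse of \<open>T\<close> simply cancels.\<close>
  then have "spray_coeff (\<lambda>z. finsleroid_K g (\<alpha> z) (w z)) x y i = X $ i"
    unfolding spray_coeff_eq metric 1 2[symmetric] by (simp only: matrix_inv_mult_cancel(1))
  moreover have "X $ i = g * (1 / q * \<beta> + g * \<kappa>) * (y - b *\<^sub>R sharp x) $ i - g * q * \<phi> $ i + \<Gamma> $ i"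
    by (simp add: X_def)
  moreover have "\<kappa> = (\<Sum>h\<in>UNIV. \<Sum>j\<in>UNIV. y $ h * raise (\<alpha> x) (w x) j * nabla \<alpha> w x j h)"
    unfolding \<kappa>_def sharp_curl_vec[OF x] by (simp add: raise_eq sharp_def)
  moreover have "v_vec (\<alpha> x) (w x) y i = (y - b *\<^sub>R sharp x) $ i"
    unfolding v_vec_eq b_def sharp_def ..
  moreover have "f_vec \<alpha> w x y i = \<phi> $ i"
    unfolding \<phi>_def by (rule f_vec_eq[OF x])
  moreover have "(\<Sum>k\<in>UNIV. \<Sum>m\<in>UNIV. christoffel \<alpha> x i k m * y $ k * y $ m) = \<Gamma> $ i"
    unfolding \<Gamma>_def L_def by (rule christoffel_contract)
  ultimately show ?thesis
    unfolding q_def \<beta>_def by (simp only:)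
qed

end

lemma smooth_on_differentiable:
  assumes "smooth_on U f" "x \<in> U"
  shows "f differentiable (at x)"
proof -
  have "Ck_on (Suc 0) U f" using assms(1) unfolding smooth_on_def by blast
  then show ?thesis using assms(2) by simp
qed

theorem proposition3:
  fixes M :: "'m topology"
    and \<A> :: "('m, 'n::finite) chart set"
    and a :: "('m, 'n) chart \<Rightarrow> real^'n \<Rightarrow> real^'n^'n"
    and b :: "('m, 'n) chart \<Rightarrow> real^'n \<Rightarrow> real^'n"
    and g :: real
    and c :: "('m, 'n) chart"
    and x y :: "real^'n"
    and i :: 'n
  assumes dim: "CARD('n) \<ge> 2"
    and manifold: "smooth_manifold M \<A>"
    and metric: "riemannian_metric \<A> a"
    and form: "one_form \<A> b"
    and unit_length: "\<forall>d\<in>\<A>. \<forall>z\<in>coord_range d. norm_sq (a d z) (b d z) = 1"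
    and charge: "-2 < g" "g < 2"
    and chart: "c \<in> \<A>"
    and point: "x \<in> coord_range c"
    and vector: "y \<noteq> 0"
    and regular: "q_scalar (a c x) (b c x) y \<noteq> 0"
  shows "spray_coeff (\<lambda>z. finsleroid_K g (a c z) (b c z)) x y i
           = spray_ansatz g (g\<^sup>2) (- g) (a c) (b c) x y i
       \<and> spray_coeff (\<lambda>z. finsleroid_K g (a c z) (b c z)) x y i
           = g * (1 / q_scalar (a c x) (b c x) y
                    * (\<Sum>j\<in>UNIV. \<Sum>h\<in>UNIV. y $ j * y $ h * nabla (a c) (b c) x j h)
                  + g * (\<Sum>h\<in>UNIV. \<Sum>j\<in>UNIV. y $ h * raise (a c x) (b c x) j
                           * nabla (a c) (b c) x j h))
               * v_vec (a c x) (b c x) y i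
             - g * q_scalar (a c x) (b c x) y * f_vec (a c) (b c) x y i
             + (\<Sum>k\<in>UNIV. \<Sum>m\<in>UNIV. christoffel (a c) x i k m * y $ k * y $ m)"
proof -
  interpret unit_form_domain "coord_range c" "a c" "b c"
  proof
    show "open (coord_range c)"
      using manifold chart by (auto simp: smooth_manifold_def is_chart_def)
    show "transpose (a c z) = a c z" if "z \<in> coord_range c" for z
      using metric chart that by (auto simp: riemannian_metric_def transpose_def vec_eq_iff)
    show "v \<bullet> (a c z *v v) > 0" if "z \<in> coord_range c" "v \<noteq> 0" for z v
      using metric chart that unfolding riemannian_metric_def inner_mult_vector by blast
    show "b c z \<bullet> (matrix_inv (a c z) *v b c z) = 1" if "z \<in> coord_range c" for z
      using unit_length chart that unfolding norm_sq_eq by blast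
    show "(\<lambda>z. a c z $ k $ l) differentiable (at z)" if "z \<in> coord_range c" for z k l
      using metric chart that unfolding riemannian_metric_def by (blast intro: smooth_on_differentiable)
    show "(\<lambda>z. b c z $ k) differentiable (at z)" if "z \<in> coord_range c" for z k
      using form chart that unfolding one_form_def by (blast intro: smooth_on_differentiable)
  qed
  have "g * (1 / q * \<beta> + g * \<kappa>) * v - g * q * f + \<gamma>
      = g * (1 / q) * \<beta> * v + g\<^sup>2 * \<kappa> * v + (- g) * q * f + \<gamma>" for q \<beta> \<kappa> v f \<gamma> :: real
    by (simp add: power2_eq_square algebra_simps)
  then show ?thesis
    unfolding spray_coeff_finsleroid[OF charge point regular] spray_ansatz_def Let_def
    by (intro conjI refl)
qed

end
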